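(* Let $p=3$. The GGS-group $\mathcal{G}=\langle a,b\rangle\leq\operatorname{Aut}T$ with constant defining vector, acting on the $3$-regular rooted tree $T$, has the $3$-CSP.
   Context: $T$ is the infinite rooted tree in which every vertex has exactly $3$ children, and $\psi:\operatorname{Aut}T\to\operatorname{Aut}T\wr\operatorname{Sym}(3)$ is the natural isomorphism obtained by identifying each subtree rooted at a first-level vertex with $T$; elements fixing the first level are identified with their images in $\operatorname{Aut}T\times\operatorname{Aut}T\times\operatorname{Aut}T$. The GGS-group with constant defining vector is $\mathcal{G}=\langle a,b\rangle$, where $a$ rigidly permutes the three subtrees rooted at the first level according to the cycle $(1\,2\,3)$, and $b$ fixes the first level and is defined recursively by $\psi(b)=(a,a,b)$. For $G\le\operatorname{Aut}T$, $\mathrm{st}_G(n)$ is the subgroup of elements of $G$ fixing every vertex at distance $n$ from the root. $G$ has the $3$-CSP if every $N\unlhd G$ such that $G/N$ is a finite $3$-group contains $\mathrm{st}_G(n)$ for some $n$. *)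

theory Defs
  imports "HOL-Algebra.Generated_Groups" "HOL-Algebra.Coset" "HOL-Library.Numeral_Type"
begin

section \<open>The 3-regular rooted tree and its automorphism group\<close>

text \<open>
  Vertices are the finite words over an alphabet with three letters, the root is the empty word
  and the children of \<open>v\<close> are the words \<open>v @ [x]\<close>. The letters are the
  elements \<open>1, 2, 3\<close> of the three-element type \<open>3\<close>, in which addition is modulo 3
  (so \<open>3 = 0\<close> in that type).
\<close>

type_synonym vertex = "3 list"

definition child_of :: "vertex \<Rightarrow> vertex \<Rightarrow> bool" where
  "child_of w v \<longleftrightarrow> (\<exists>x. w = v @ [x])"

definition AutT :: "(vertex \<Rightarrow> vertex) monoid" where
  "AutT = \<lparr>carrier = {f. bij f \<and> f [] = [] \<and> (\<forall>v w. child_of (f w) (f v) \<longleftrightarrow> child_of w v)},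
           mult = (\<circ>), one = id\<rparr>"

text \<open>The components of \<open>\<psi>\<close>: the permutation of the first level, and the
  automorphism induced by \<open>f\<close> from the subtree rooted at \<open>[x]\<close> to its image, both
  subtrees being identified with the whole tree by deleting the first letter.\<close>

definition level1_perm :: "(vertex \<Rightarrow> vertex) \<Rightarrow> 3 \<Rightarrow> 3" where
  "level1_perm f x = hd (f [x])"

definition level1_section :: "(vertex \<Rightarrow> vertex) \<Rightarrow> 3 \<Rightarrow> vertex \<Rightarrow> vertex" where
  "level1_section f x w = tl (f (x # w))"


section \<open>Level stabilizers and the \<open>p\<close>-congruence subgroup property\<close>

definition level_stab :: "(vertex \<Rightarrow> vertex) set \<Rightarrow> nat \<Rightarrow> (vertex \<Rightarrow> vertex) set" where
  "level_stab G n = {g \<in> G. \<forall>v. length v = n \<longrightarrow> g v = v}"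

definition finite_p_group :: "nat \<Rightarrow> ('a, 'b) monoid_scheme \<Rightarrow> bool" where
  "finite_p_group p G \<longleftrightarrow> group G \<and> finite (carrier G) \<and> (\<exists>k. order G = p ^ k)"

definition has_CSP :: "nat \<Rightarrow> (vertex \<Rightarrow> vertex) set \<Rightarrow> bool" where
  "has_CSP p G \<longleftrightarrow>
     (\<forall>N. N \<lhd> AutT\<lparr>carrier := G\<rparr> \<and> finite_p_group p (AutT\<lparr>carrier := G\<rparr> Mod N)
        \<longrightarrow> (\<exists>n. level_stab G n \<subseteq> N))"


section \<open>The GGS-group with constant defining vector\<close>

fun gen_a :: "vertex \<Rightarrow> vertex" where
  "gen_a [] = []"
| "gen_a (x # w) = (x + 1) # w"

fun gen_b :: "vertex \<Rightarrow> vertex" where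
  "gen_b [] = []"
| "gen_b (x # w) = x # (if x = 3 then gen_b w else gen_a w)"

definition GGS :: "(vertex \<Rightarrow> vertex) set" where
  "GGS = generate AutT {gen_a, gen_b}"


section \<open>Basic facts\<close>

lemma AutT_simps [simp]:
  "mult AutT = (\<circ>)" "one AutT = id"
  by (simp_all add: AutT_def)

lemma AutT_inv:
  assumes "f \<in> carrier AutT"
  shows "inv_into UNIV f \<in> carrier AutT"
proof -
  have bij: "bij f" and root: "f [] = []"
    and ch: "\<And>v w. child_of (f w) (f v) \<longleftrightarrow> child_of w v"
    using assms by (auto simp: AutT_def)
  have f_inv: "f (inv_into UNIV f v) = v" for v
    using bij by (simp add: bij_is_surj surj_f_inv_f)
  have "inv_into UNIV f [] = []"
    using bij root by (metis bij_is_inj inv_f_f)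
  moreover have "child_of (inv_into UNIV f w) (inv_into UNIV f v) \<longleftrightarrow> child_of w v" for v w
    using ch[of "inv_into UNIV f w" "inv_into UNIV f v"] by (simp add: f_inv)
  ultimately show ?thesis
    using bij by (simp add: AutT_def bij_imp_bij_inv)
qed

lemma group_AutT: "group AutT"
proof (rule groupI)
  fix f assume f: "f \<in> carrier AutT"
  then have "inv_into UNIV f \<circ> f = id"
    by (simp add: AutT_def bij_is_inj)
  with f show "\<exists>g\<in>carrier AutT. g \<otimes>\<^bsub>AutT\<^esub> f = \<one>\<^bsub>AutT\<^esub>"
    using AutT_inv by auto
qed (auto simp: AutT_def bij_comp o_assoc)

lemma length_gen_a [simp]: "length (gen_a w) = length w"
  by (cases w) auto

lemma length_gen_b [simp]: "length (gen_b w) = length w"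
  by (induction w) auto

lemma gen_a_cube: "gen_a (gen_a (gen_a w)) = w"
  by (cases w) (auto simp: add.assoc)

lemma gen_b_cube: "gen_b (gen_b (gen_b w)) = w"
  by (induction w) (auto simp: gen_a_cube)

lemma child_of_butlast: "child_of w v \<longleftrightarrow> w \<noteq> [] \<and> butlast w = v"
  unfolding child_of_def by (metis append_butlast_last_id butlast_snoc snoc_eq_iff_butlast)

lemma butlast_gen_a: "butlast (gen_a w) = gen_a (butlast w)"
  by (cases w) auto

lemma butlast_gen_b: "butlast (gen_b w) = gen_b (butlast w)"
proof (induction w)
  case (Cons x w)
  have "gen_a w = [] \<longleftrightarrow> w = []" "gen_b w = [] \<longleftrightarrow> w = []"
    by (metis length_0_conv length_gen_a, metis length_0_conv length_gen_b)
  with Cons show ?case by (auto simp: butlast_gen_a)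
qed simp

lemma AutT_I:
  assumes "bij f" "\<And>w. length (f w) = length w" "\<And>w. butlast (f w) = f (butlast w)"
  shows "f \<in> carrier AutT"
proof -
  have nil: "f w = [] \<longleftrightarrow> w = []" for w
    by (metis assms(2) length_0_conv)
  have "f u = f v \<longleftrightarrow> u = v" for u v
    using assms(1) by (simp add: bij_is_inj inj_eq)
  then show ?thesis
    using assms(1) nil by (auto simp: AutT_def child_of_butlast assms(3))
qed

lemma gen_a_in_AutT: "gen_a \<in> carrier AutT"
  by (rule AutT_I[OF o_bij[of "gen_a \<circ> gen_a"]]) (auto simp: gen_a_cube butlast_gen_a)

lemma gen_b_in_AutT: "gen_b \<in> carrier AutT"
  by (rule AutT_I[OF o_bij[of "gen_b \<circ> gen_b"]]) (auto simp: gen_b_cube butlast_gen_b)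

lemma GGS_subgroup: "subgroup GGS AutT"
  unfolding GGS_def
  by (rule group.generate_is_subgroup[OF group_AutT]) (simp add: gen_a_in_AutT gen_b_in_AutT)

lemma psi_gen_a: "level1_perm gen_a x = x + 1" "level1_section gen_a x = id"
  by (auto simp: level1_perm_def level1_section_def)

lemma psi_gen_b:
  "level1_perm gen_b x = x"
  "level1_section gen_b 1 = gen_a" "level1_section gen_b 2 = gen_a"
  "level1_section gen_b 3 = gen_b"
  by (auto simp: level1_perm_def level1_section_def)

end

theory Submission
  imports Defs "HOL-Library.Product_Plus" "HOL-Algebra.Multiplicative_Group"
begin

text \<open>
  Let \<open>K\<close> be the normal closure of \<open>b a\<^sup>-\<^sup>1\<close>. The quotient by \<open>K'\<close> is
  \<open>\<int>[\<omega>] \<rtimes> C\<^sub>3\<close> with \<open>\<omega>\<close> a primitive cube root of unity, where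
  \<open>a \<mapsto> (0, 1)\<close> and \<open>b \<mapsto> (1, 1)\<close>. If \<open>\<lambda>\<^sub>x\<close> is the class in \<open>\<int>[\<omega>]\<close>
  of the section at \<open>x\<close> of an element of \<open>K\<close> that fixes the first level, then the class
  of that element is \<open>\<Sum> \<omega>\<^sup>x \<lambda>\<^sub>x\<close>, and \<open>\<Sum> \<lambda>\<^sub>x = 0\<close>. So each level of a
  stabilizer contributes a factor \<open>1 - \<omega>\<close>, and as \<open>(1 - \<omega>)\<^sup>2\<close> is an associate of
  \<open>3\<close>, elements of deep stabilizers are products of \<open>3\<^sup>k\<close>-th powers modulo \<open>K'\<close>. The
  same holds for \<open>K'\<close> modulo \<open>K' \<times> K' \<times> K' \<le> K'\<close>, because
  \<open>K' / (K' \<times> K' \<times> K')\<close> is the copy \<open>{(\<lambda>, \<omega>\<lambda>, \<omega>\<^sup>2\<lambda>)}\<close> of \<open>\<int>[\<omega>]\<close>, and hence for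
  each step of the series \<open>K' \<ge> (K')\<^sup>3 \<ge> (K')\<^sup>9 \<ge> \<dots>\<close>.

  Let \<open>N\<close> be normal of index a power of 3. It is nontrivial, so it contains a copy of
  \<open>K''\<close> at every vertex of some level, and therefore a copy of \<open>[K, K']\<close> at every vertex
  of the next. Modulo \<open>[K, K']\<close> the group \<open>K'\<close> is cyclic and every element of
  \<open>K' \<times> 1 \<times> 1\<close> is a cube; iterating this, \<open>N\<close> contains a term of the series, and one
  climbs back from it to a level stabilizer because \<open>N\<close> contains all \<open>3\<^sup>k\<close>-th powers.
\<close>

section \<open>Normal subgroups and congruences in additive notation\<close>

definition subgrp :: "'a::group_add set \<Rightarrow> bool" where
  "subgrp H \<longleftrightarrow> 0 \<in> H \<and> (\<forall>x\<in>H. \<forall>y\<in>H. x + y \<in> H) \<and> (\<forall>x\<in>H. - x \<in> H)"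

definition normal_subgrp :: "'a::group_add set \<Rightarrow> bool" where
  "normal_subgrp H \<longleftrightarrow> subgrp H \<and> (\<forall>g. \<forall>h\<in>H. g + h - g \<in> H)"

definition comm :: "'a::group_add \<Rightarrow> 'a \<Rightarrow> 'a" where
  "comm x y = x + y - x - y"

inductive_set gen :: "'a::group_add set \<Rightarrow> 'a set" for S where
  zero: "0 \<in> gen S"
| add: "s \<in> S \<Longrightarrow> g \<in> gen S \<Longrightarrow> s + g \<in> gen S"
| minus: "s \<in> S \<Longrightarrow> g \<in> gen S \<Longrightarrow> - s + g \<in> gen S"

primrec nmul :: "nat \<Rightarrow> 'a::group_add \<Rightarrow> 'a" where
  "nmul 0 x = 0"
| "nmul (Suc n) x = x + nmul n x"

definition eqm :: "'a::group_add set \<Rightarrow> 'a \<Rightarrow> 'a \<Rightarrow> bool" where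
  "eqm H x y \<longleftrightarrow> x - y \<in> H"

text \<open>Normal form: right-nested sums of possibly negated terms.
  \<open>add_uminus_conv_diff\<close> rewrites the other way and would loop with it.\<close>

lemmas grp_simps = diff_conv_add_uminus add.assoc minus_add

declare add_uminus_conv_diff [simp del]

lemma subgrpD:
  assumes "subgrp H"
  shows "0 \<in> H" "x \<in> H \<Longrightarrow> y \<in> H \<Longrightarrow> x + y \<in> H" "x \<in> H \<Longrightarrow> - x \<in> H"
    "x \<in> H \<Longrightarrow> y \<in> H \<Longrightarrow> x - y \<in> H"
  using assms unfolding subgrp_def by (auto simp: grp_simps)

lemma normal_subgrpD:
  assumes "normal_subgrp H"
  shows "subgrp H" "h \<in> H \<Longrightarrow> g + h - g \<in> H" "h \<in> H \<Longrightarrow> - g + h + g \<in> H"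
proof -
  show "subgrp H" "h \<in> H \<Longrightarrow> g + h - g \<in> H"
    using assms unfolding normal_subgrp_def by auto
  assume "h \<in> H"
  then have "- g + h - (- g) \<in> H" using assms unfolding normal_subgrp_def by blast
  then show "- g + h + g \<in> H" by (simp add: grp_simps)
qed

lemma comm_in_normal:
  assumes "normal_subgrp H" "x \<in> H \<or> y \<in> H"
  shows "comm x y \<in> H"
proof -
  note sg = subgrpD[OF normal_subgrpD(1)[OF assms(1)]] and nm = normal_subgrpD[OF assms(1)]
  have "comm x y = x + (y - x - y)" "comm x y = (x + y - x) - y"
    by (simp_all add: comm_def grp_simps)
  moreover have "x \<in> H \<Longrightarrow> y - x - y \<in> H" using nm(2)[of "- x" y] sg(3) by (simp add: grp_simps)
  ultimately show ?thesis using sg(2,4) nm(2) assms(2) by metis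
qed

lemma nmul_add: "nmul (m + n) x = nmul m x + nmul n x"
  by (induction m) (auto simp: add.assoc)

lemma nmul_mult: "nmul (m * n) x = nmul m (nmul n x)"
  by (induction m) (auto simp: nmul_add)

lemma nmul_zero [simp]: "nmul n 0 = 0"
  by (induction n) auto

lemma nmul_conj: "nmul n (g + h - g) = g + nmul n h - g"
  by (induction n) (auto simp: grp_simps)

lemma nmul_in_subgrp: "subgrp H \<Longrightarrow> x \<in> H \<Longrightarrow> nmul n x \<in> H"
  by (induction n) (auto simp: subgrpD)

lemma gen_incl: "s \<in> S \<Longrightarrow> s \<in> gen S"
  using gen.add[OF _ gen.zero, of s S] by simp

lemma gen_add_closed: "g \<in> gen S \<Longrightarrow> h \<in> gen S \<Longrightarrow> g + h \<in> gen S"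
  by (induction rule: gen.induct) (auto simp: add.assoc intro: gen.intros)

lemma gen_minus_closed: "g \<in> gen S \<Longrightarrow> - g \<in> gen S"
proof (induction rule: gen.induct)
  case (add s g)
  have "- g + (- s + 0) \<in> gen S" using add by (intro gen_add_closed gen.intros) auto
  then show ?case by (simp add: minus_add)
next
  case (minus s g)
  have "- g + (s + 0) \<in> gen S" using minus by (intro gen_add_closed gen.intros) auto
  then show ?case by (simp add: minus_add)
qed (simp add: gen.zero)

lemma subgrp_gen: "subgrp (gen S)"
  unfolding subgrp_def by (auto intro: gen.zero gen_add_closed gen_minus_closed)

lemma gen_subset: "subgrp H \<Longrightarrow> S \<subseteq> H \<Longrightarrow> gen S \<subseteq> H"
proof
  fix x assume H: "subgrp H" "S \<subseteq> H" and "x \<in> gen S"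
  from this(3) show "x \<in> H"
    by (induction rule: gen.induct) (use H in \<open>auto simp: subgrpD\<close>)
qed

lemma normal_gen:
  assumes "\<And>g s. s \<in> S \<Longrightarrow> g + s - g \<in> S"
  shows "normal_subgrp (gen S)"
proof -
  have "g + h - g \<in> gen S" if "h \<in> gen S" for g h
    using that
  proof (induction rule: gen.induct)
    case (add s h)
    have "(g + s - g) + (g + h - g) \<in> gen S"
      using add assms by (intro gen.add) auto
    then show ?case by (simp add: grp_simps)
  next
    case (minus s h)
    have "- (g + s - g) + (g + h - g) \<in> gen S"
      using minus assms by (intro gen.minus) auto
    then show ?case by (simp add: grp_simps)
  qed (simp add: gen.zero)
  then show ?thesis unfolding normal_subgrp_def using subgrp_gen by blast
qed

lemma eqm_refl: "normal_subgrp H \<Longrightarrow> eqm H x x"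
  by (simp add: eqm_def subgrpD normal_subgrpD)

lemma eqm_sym: "normal_subgrp H \<Longrightarrow> eqm H x y \<Longrightarrow> eqm H y x"
  unfolding eqm_def using subgrpD(3)[OF normal_subgrpD(1), of H "x - y"] by (simp add: grp_simps)

lemma eqm_trans: "normal_subgrp H \<Longrightarrow> eqm H x y \<Longrightarrow> eqm H y z \<Longrightarrow> eqm H x z"
  unfolding eqm_def using subgrpD(2)[OF normal_subgrpD(1), of H "x - y" "y - z"]
  by (simp add: grp_simps)

lemma eqm_add:
  assumes "normal_subgrp H" "eqm H x x'" "eqm H y y'"
  shows "eqm H (x + y) (x' + y')"
proof -
  have "(x + (y - y') - x) + (x - x') \<in> H"
    using assms by (auto simp: eqm_def intro: subgrpD normal_subgrpD)
  then show ?thesis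
    by (simp add: eqm_def grp_simps)
qed

lemma eqm_minus:
  assumes "normal_subgrp H" "eqm H x x'"
  shows "eqm H (- x) (- x')"
proof -
  have "x' - x \<in> H" using eqm_sym[OF assms] by (simp add: eqm_def)
  then have "- x + (x' - x) + x \<in> H" by (rule normal_subgrpD(3)[OF assms(1)])
  then show ?thesis by (simp add: eqm_def grp_simps)
qed

lemma eqm_nmul: "normal_subgrp H \<Longrightarrow> eqm H x y \<Longrightarrow> eqm H (nmul n x) (nmul n y)"
  by (induction n) (auto simp: eqm_refl eqm_add)

lemma eqm_comm: "normal_subgrp H \<Longrightarrow> comm x y \<in> H \<longleftrightarrow> eqm H (x + y) (y + x)"
  by (simp add: comm_def eqm_def grp_simps)

lemma eqm_in: "normal_subgrp H \<Longrightarrow> eqm H x y \<Longrightarrow> y \<in> H \<Longrightarrow> x \<in> H"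
  unfolding eqm_def using subgrpD(2)[OF normal_subgrpD(1), of H "x - y" y] by (simp add: grp_simps)

lemma subgrp_centralizer:
  assumes "normal_subgrp H"
  shows "subgrp {g. comm g y \<in> H}"
proof -
  note nt = eqm_trans[OF assms] and ns = eqm_sym[OF assms] and na = eqm_add[OF assms]
    and nr = eqm_refl[OF assms]
  have "eqm H (x + x' + y) (y + (x + x'))"
    if "eqm H (x + y) (y + x)" "eqm H (x' + y) (y + x')" for x x'
    using nt[OF na[OF nr[of x] that(2)], of "x + y + x'"] na[OF that(1) nr[of x']]
    by (metis add.assoc nr nt)
  moreover have "eqm H (- x + y) (y + - x)" if "eqm H (x + y) (y + x)" for x
    using na[OF nr[of "- x"] na[OF ns[OF that] nr[of "- x"]]] by (simp add: grp_simps)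
  ultimately show ?thesis
    unfolding subgrp_def eqm_comm[OF assms] using nr by auto
qed

lemma comm_swap: "comm y x = - comm x y"
  by (simp add: comm_def grp_simps)

lemma comm_sym: "normal_subgrp H \<Longrightarrow> comm x y \<in> H \<longleftrightarrow> comm y x \<in> H"
  by (metis comm_swap minus_minus normal_subgrpD(1) subgrpD(3))

lemma comm_nmul: "normal_subgrp H \<Longrightarrow> comm x y \<in> H \<Longrightarrow> comm (nmul m x) (nmul n y) \<in> H"
  using nmul_in_subgrp[OF subgrp_centralizer] comm_sym by (metis mem_Collect_eq)

lemma eqm_nmul_add:
  assumes H: "normal_subgrp H" and "comm x y \<in> H"
  shows "eqm H (nmul n (x + y)) (nmul n x + nmul n y)"
proof (induction n)
  case (Suc n)
  have "comm y (nmul n x) \<in> H"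
    using comm_nmul[OF H, of y x 1 n] assms by (simp add: comm_sym)
  then have 1: "eqm H (y + nmul n x) (nmul n x + y)" by (simp add: eqm_comm[OF H])
  have "eqm H (x + y + nmul n (x + y)) (x + y + (nmul n x + nmul n y))"
    by (intro eqm_add[OF H] eqm_refl[OF H] Suc)
  moreover have "eqm H (x + ((y + nmul n x) + nmul n y)) (x + ((nmul n x + y) + nmul n y))"
    by (intro eqm_add[OF H] eqm_refl[OF H] 1)
  ultimately show ?case using eqm_trans[OF H] by (simp add: add.assoc)
qed (simp add: eqm_refl H)

section \<open>The GGS-group as a type\<close>

text \<open>As a type the group is an instance of the (noncommutative) class \<open>group_add\<close>, so
  composition is written \<open>+\<close>.\<close>

typedef gg = "GGS" 
  using group.generate_in_carrier group_AutT subgroup.one_closed[OF GGS_subgroup] by blast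

setup_lifting type_definition_gg

lemma GGS_bij: "g \<in> GGS \<Longrightarrow> bij g"
  using subgroup.mem_carrier[OF GGS_subgroup] by (auto simp: AutT_def)

lemma inv_AutT: "g \<in> GGS \<Longrightarrow> inv\<^bsub>AutT\<^esub> g = inv_into UNIV g"
proof -
  assume g: "g \<in> GGS"
  have "inv_into UNIV g \<otimes>\<^bsub>AutT\<^esub> g = \<one>\<^bsub>AutT\<^esub>"
    using GGS_bij[OF g] by (simp add: bij_is_inj)
  then show ?thesis
    using g AutT_inv subgroup.mem_carrier[OF GGS_subgroup] group.inv_equality[OF group_AutT] by metis
qed

lemma GGS_closed: "g \<in> GGS \<Longrightarrow> h \<in> GGS \<Longrightarrow> g \<circ> h \<in> GGS" "g \<in> GGS \<Longrightarrow> inv_into UNIV g \<in> GGS"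
  "id \<in> GGS" "gen_a \<in> GGS" "gen_b \<in> GGS"
  using subgroup.m_closed[OF GGS_subgroup, of g h] subgroup.m_inv_closed[OF GGS_subgroup, of g]
    subgroup.one_closed[OF GGS_subgroup] inv_AutT[of g]
  by (auto simp: GGS_def intro: generate.incl)

instantiation gg :: group_add
begin
lift_definition zero_gg :: gg is id by (rule GGS_closed)
lift_definition plus_gg :: "gg \<Rightarrow> gg \<Rightarrow> gg" is "(\<circ>)" by (rule GGS_closed)
lift_definition uminus_gg :: "gg \<Rightarrow> gg" is "inv_into UNIV" by (rule GGS_closed)
definition minus_gg :: "gg \<Rightarrow> gg \<Rightarrow> gg" where "minus_gg g h = g + - h"
instance
  by standard (transfer, auto simp: minus_gg_def o_assoc GGS_bij bij_is_inj; fail)+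
end

lift_definition act :: "gg \<Rightarrow> vertex \<Rightarrow> vertex" is "\<lambda>g. g" .
lift_definition ga :: gg is gen_a by (rule GGS_closed)
lift_definition gb :: gg is gen_b by (rule GGS_closed)

lemma act_simps [simp]: "act (g + h) v = act g (act h v)" "act 0 v = v"
  "act ga v = gen_a v" "act gb v = gen_b v"
  by (transfer; simp)+

lemma act_minus [simp]: "act (- g) (act g v) = v" "act g (act (- g) v) = v"
  by (simp_all flip: act_simps(1))

lemma act_ext: "(\<And>v. act g v = act h v) \<Longrightarrow> g = h"
  by transfer auto

lemma ga_cube: "ga + (ga + ga) = 0"
  by (rule act_ext) (simp add: gen_a_cube)

lemma gb_cube: "gb + (gb + gb) = 0"
  by (rule act_ext) (simp add: gen_b_cube)

lemma minus_ga: "- ga = ga + ga" and minus_gb: "- gb = gb + gb"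
  using ga_cube gb_cube by (auto simp: minus_unique)

text \<open>Both generators have order 3, so inverses are positive words and the two multiplication
  cases suffice.\<close>

lemma gg_induct [case_names zero a b]:
  assumes "P 0" "\<And>g. P g \<Longrightarrow> P (ga + g)" "\<And>g. P g \<Longrightarrow> P (gb + g)"
  shows "P g"
proof -
  have minus: "P (- ga + g)" "P (- gb + g)" if "P g" for g
    unfolding minus_ga minus_gb add.assoc using that assms by auto
  \<comment> \<open>The arbitrary right factor \<open>h\<close> lets the product case
    \<open>eng\<close> compose.\<close>
  have left: "\<forall>h. P h \<longrightarrow> P (Abs_gg f + h)" if "f \<in> GGS" for f
    using that unfolding GGS_def
  proof (induction rule: generate.induct)
    case one
    have "Abs_gg \<one>\<^bsub>AutT\<^esub> = 0" by (simp add: zero_gg_def)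
    then show ?case by (simp del: AutT_simps)
  next
    case (incl h)
    then have "Abs_gg h \<in> {ga, gb}" by (auto simp: ga_def gb_def)
    then show ?case using assms by auto
  next
    case (inv h)
    then have "h \<in> GGS" "Abs_gg h \<in> {ga, gb}" by (auto simp: ga_def gb_def GGS_closed)
    then have "Abs_gg (inv\<^bsub>AutT\<^esub> h) \<in> {- ga, - gb}"
      using inv_AutT[of h] uminus_gg.abs_eq[of h] by (auto simp: eq_onp_def)
    then show ?case using minus by auto
  next
    case (eng h1 h2)
    then have "Abs_gg (h1 \<otimes>\<^bsub>AutT\<^esub> h2) = Abs_gg h1 + Abs_gg h2"
      by (simp add: plus_gg.abs_eq eq_onp_def GGS_def)
    with eng.IH show ?case by (simp add: add.assoc del: AutT_simps)
  qed
  have "Abs_gg (Rep_gg g) + 0 = g" by (simp add: Rep_gg_inverse)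
  then show ?thesis using left[OF Rep_gg[of g]] assms(1) by metis
qed

section \<open>First-level rotation and sections\<close>

lemma act_Cons_ex: "\<exists>t. \<forall>x. \<exists>h. \<forall>w. act g (x # w) = (x + t) # act h w"
proof (induction g rule: gg_induct)
  case zero
  show ?case by (rule exI[of _ 0]) (auto intro: exI[of _ 0])
next
  case (a g)
  then obtain t where "\<forall>x. \<exists>h. \<forall>w. act g (x # w) = (x + t) # act h w" by blast
  then show ?case by (intro exI[of _ "t + 1"] allI) (metis act_simps(1,3) gen_a.simps(2) add.assoc)
next
  case (b g)
  then obtain t where t: "\<forall>x. \<exists>h. \<forall>w. act g (x # w) = (x + t) # act h w" by blast
  show ?case
  proof (intro exI[of _ t] allI)
    fix x
    obtain h where h: "\<forall>w. act g (x # w) = (x + t) # act h w" using t by blast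
    show "\<exists>h. \<forall>w. act (gb + g) (x # w) = (x + t) # act h w"
      by (rule exI[of _ "if x + t = 3 then gb + h else ga + h"]) (simp add: h)
  qed
qed

text \<open>All elements permute the first level by a rotation, so a single number records
  the action there.\<close>

definition rot :: "gg \<Rightarrow> 3" where
  "rot g = hd (act g [0])"

definition sec :: "gg \<Rightarrow> 3 \<Rightarrow> gg" where
  "sec g x = (SOME h. \<forall>w. act g (x # w) = (x + rot g) # act h w)"

lemma act_Cons [simp]: "act g (x # w) = (x + rot g) # act (sec g x) w"
proof -
  obtain t where t: "\<forall>x. \<exists>h. \<forall>w. act g (x # w) = (x + t) # act h w" using act_Cons_ex by blast
  then have "rot g = t" unfolding rot_def by (metis add_0 list.sel(1))
  then have "\<exists>h. \<forall>w. act g (x # w) = (x + rot g) # act h w" using t by blast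
  from someI_ex[OF this] show ?thesis unfolding sec_def by blast
qed

lemma act_Nil [simp]: "act g [] = []"
  by (induction g rule: gg_induct) auto

lemma gg_eqI: "rot g = rot h \<Longrightarrow> (\<And>x. sec g x = sec h x) \<Longrightarrow> g = h"
  by (rule act_ext, case_tac v) auto

lemma rot_sec_unique:
  assumes "\<forall>x w. act g (x # w) = (x + t) # act (h x) w"
  shows "rot g = t" "sec g x = h x"
  using assms by (auto intro!: act_ext)

lemma rot_zero [simp]: "rot 0 = 0" and sec_zero [simp]: "sec 0 x = 0"
proof -
  have "\<forall>x w. act 0 (x # w) = (x + 0) # act 0 w" by (simp del: act_Cons)
  from rot_sec_unique[OF this] show "rot 0 = 0" "sec 0 x = 0" by auto
qed

lemma rot_add [simp]: "rot (g + h) = rot g + rot h"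
  and sec_add [simp]: "sec (g + h) x = sec g (x + rot h) + sec h x"
proof -
  have "act (g + h) (x # w) = (x + (rot g + rot h)) # act (sec g (x + rot h) + sec h x) w" for x w
    by (simp del: act_Cons) (simp add: ac_simps)
  then show "rot (g + h) = rot g + rot h" "sec (g + h) x = sec g (x + rot h) + sec h x"
    using rot_sec_unique[of "g + h" "rot g + rot h" "\<lambda>x. sec g (x + rot h) + sec h x"] by blast+
qed

lemma rot_minus [simp]: "rot (- g) = - rot g"
proof -
  have "rot (- g) + rot g = 0" unfolding rot_add[symmetric] by simp
  then show ?thesis by (simp add: eq_neg_iff_add_eq_0)
qed

lemma sec_minus [simp]: "sec (- g) x = - sec g (x - rot g)"
proof -
  have "sec (- g) x + sec g (x - rot g) = sec (- g + g) (x - rot g)"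
    unfolding sec_add by simp
  then show ?thesis by (simp add: eq_neg_iff_add_eq_0 del: sec_add)
qed

lemma rot_diff [simp]: "rot (g - h) = rot g - rot h"
  unfolding diff_conv_add_uminus[of g h] rot_add rot_minus by simp

lemma sec_diff [simp]: "sec (g - h) x = sec g (x - rot h) - sec h (x - rot h)"
  unfolding diff_conv_add_uminus[of g h] sec_add rot_minus sec_minus by (simp add: grp_simps)

lemma three_eq_zero: "(3::3) = 0"
  by simp

lemma rot_ga [simp]: "rot ga = 1" and sec_ga [simp]: "sec ga x = 0"
proof -
  have "\<forall>x w. act ga (x # w) = (x + 1) # act 0 w" by (simp del: act_Cons)
  from rot_sec_unique[OF this] show "rot ga = 1" "sec ga x = 0" by auto
qed

lemma rot_gb [simp]: "rot gb = 0" and sec_gb [simp]: "sec gb x = (if x = 0 then gb else ga)"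
proof -
  have "\<forall>x w. act gb (x # w) = (x + 0) # act (if x = 0 then gb else ga) w"
    by (simp del: act_Cons)
  from rot_sec_unique[OF this] show "rot gb = 0" "sec gb x = (if x = 0 then gb else ga)" by auto
qed

section \<open>The homomorphism to \<open>\<int>[\<omega>] \<rtimes> C\<^sub>3\<close>\<close>

text \<open>The pair \<open>(i, j)\<close> stands for \<open>i + j\<omega>\<close>; \<open>om\<close> is multiplication by
  \<open>\<omega>\<close> and \<open>eps\<close> is reduction modulo \<open>1 - \<omega>\<close>.\<close>

type_synonym eisenstein = "int \<times> int"

definition om :: "eisenstein \<Rightarrow> eisenstein" where
  "om p = (- snd p, fst p - snd p)"

definition omp :: "3 \<Rightarrow> eisenstein \<Rightarrow> eisenstein" where
  "omp s p = (if s = 0 then p else if s = 1 then om p else om (om p))"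

definition eps :: "eisenstein \<Rightarrow> 3" where
  "eps p = of_int (fst p + snd p)"

lemma exhaust3: "(x::3) = 0 \<or> x = 1 \<or> x = 2"
proof (induct x)
  case (of_int z)
  then have "z = 0 \<or> z = 1 \<or> z = 2" by fastforce
  then show ?case by auto
qed

lemma all3: "(\<forall>x::3. P x) \<longleftrightarrow> P 0 \<and> P 1 \<and> P 2"
  using exhaust3 by metis

lemma om_simps [simp]: "om 0 = 0" "om (p + q) = om p + om q" "om (- p) = - om p"
  "om (p - q) = om p - om q" "om (om (om p)) = p"
  by (simp_all add: om_def prod_eq_iff)

lemma omp_simps [simp]: "omp 0 p = p" "omp 1 p = om p" "omp 2 p = om (om p)"
  "omp s 0 = 0" "omp s (p + q) = omp s p + omp s q" "omp s (- p) = - omp s p"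
  "omp s (p - q) = omp s p - omp s q"
  by (auto simp: omp_def)

lemma omp_add: "omp (s + t) p = omp s (omp t p)"
proof -
  have "(1 + 2 :: 3) = 0" "(2 + 1 :: 3) = 0" "(2 + 2 :: 3) = 1" "(1 + 1 :: 3) = 2" by simp_all
  then show ?thesis using exhaust3[of s] exhaust3[of t] by (elim disjE) (simp_all only: omp_simps add_0 add_0_right om_simps)
qed

lemma of_int_mult3: "of_int (3 * z) = (0::3)"
  by (simp only: of_int_mult of_int_numeral three_eq_zero) simp

lemma eps_om [simp]: "eps (om p) = eps p"
proof -
  have "fst (om p) + snd (om p) = (fst p + snd p) + - (3 * snd p)" by (simp add: om_def)
  then show ?thesis unfolding eps_def
    by (simp only: of_int_add[of "fst p + snd p"] of_int_minus of_int_mult3) simp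
qed

lemma eps_simps [simp]: "eps 0 = 0" "eps (p + q) = eps p + eps q" "eps (- p) = - eps p"
  "eps (p - q) = eps p - eps q" "eps (omp s p) = eps p"
proof -
  show "eps (omp s p) = eps p" by (simp add: omp_def)
qed (simp_all add: eps_def)

text \<open>The graph of the homomorphism, as the subgroup generated by the images of the
  generators. That it is single-valued (\<open>cl_unique\<close>) is proved by the same descent through the
  level stabilizers that bounds the classes of their elements.\<close>

inductive cl :: "gg \<Rightarrow> eisenstein \<Rightarrow> 3 \<Rightarrow> bool" where
  zero: "cl 0 0 0"
| a: "cl g l s \<Longrightarrow> cl (ga + g) (om l) (s + 1)"
| b: "cl g l s \<Longrightarrow> cl (gb + g) ((1, 0) + om l) (s + 1)"

lemma cl_ga: "cl ga 0 1" and cl_gb: "cl gb (1, 0) 1"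
  using cl.a[OF cl.zero] cl.b[OF cl.zero] by simp_all

lemma cl_add: "cl g l s \<Longrightarrow> cl h m t \<Longrightarrow> cl (g + h) (l + omp s m) (s + t)"
proof (induction rule: cl.induct)
  case (a g l s)
  have "omp (s + 1) m = om (omp s m)" by (simp add: add.commute[of s] omp_add)
  then show ?case using cl.a[OF a.IH[OF a.prems]] by (simp add: add.assoc ac_simps)
next
  case (b g l s)
  have "omp (s + 1) m = om (omp s m)" by (simp add: add.commute[of s] omp_add)
  then show ?case using cl.b[OF b.IH[OF b.prems]] by (simp add: add.assoc ac_simps)
qed simp

lemma cl_total: "\<exists>l s. cl g l s"
  by (induction g rule: gg_induct) (blast intro: cl.intros)+

text \<open>The sum 1 + \<omega> + ... + \<omega>^(u-1), well defined modulo 3 since 1 + \<omega> +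
  \<omega>^2 = 0.\<close>

definition geom :: "3 \<Rightarrow> eisenstein" where
  "geom u = (if u = 0 then 0 else if u = 1 then (1, 0) else (1, 1))"

lemma geom_Suc: "geom (u + 1) = (1, 0) + om (geom u)"
proof -
  have "(2 + 1 :: 3) = 0" "(1 + 1 :: 3) = 2" by simp_all
  then show ?thesis using exhaust3[of u] by (auto simp: geom_def om_def prod_eq_iff)
qed

lemma eps_geom: "eps (geom u) = u"
  using exhaust3[of u] by (auto simp: geom_def eps_def)

text \<open>Left multiplication by \<open>ga\<close> changes only the rotation. Multiplication by
  \<open>gb\<close> multiplies every section class by \<omega> and adds 1 to exactly one of them,
  where \<open>x + rot g = 0\<close> and the total weight is therefore 1; on the plain sum this is
  the recursion \<open>geom_Suc\<close>.\<close>

lemma cl_sections: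
  assumes "cl g l s"
  shows "\<exists>A u. (\<forall>x. cl (sec g x) (A x) u) \<and> s = rot g + u \<and>
    l = omp (rot g) (A 0 + om (A 1) + om (om (A 2))) \<and> A 0 + A 1 + A 2 = geom u"
  using assms
proof (induction rule: cl.induct)
  case zero
  show ?case by (rule exI[of _ "\<lambda>_. 0"], rule exI[of _ 0]) (auto simp: cl.zero geom_def)
next
  case (a g l s)
  then obtain A u where A: "\<forall>x. cl (sec g x) (A x) u" "s = rot g + u"
    "l = omp (rot g) (A 0 + om (A 1) + om (om (A 2)))" "A 0 + A 1 + A 2 = geom u" by blast
  have "om l = omp (1 + rot g) (A 0 + om (A 1) + om (om (A 2)))"
    unfolding omp_add A(3) by simp
  then show ?case using A by (intro exI[of _ A] exI[of _ u]) (auto simp: ac_simps)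
next
  case (b g l s)
  then obtain A u where A: "\<forall>x. cl (sec g x) (A x) u" "s = rot g + u"
    "l = omp (rot g) (A 0 + om (A 1) + om (om (A 2)))" "A 0 + A 1 + A 2 = geom u" by blast
  define B where "B x = (if x + rot g = 0 then (1, 0) else 0) + om (A x)" for x
  have "cl (sec (gb + g) x) (B x) (u + 1)" for x
    using cl_add[OF cl_gb A(1)[rule_format, of x]] cl_add[OF cl_ga A(1)[rule_format, of x]]
    by (auto simp: B_def add.commute[of u])
  moreover have "(1, 0) + om l = omp (rot g) (B 0 + om (B 1) + om (om (B 2)))"
  proof -
    have "(2 + 1 :: 3) = 0" "(1 + 2 :: 3) = 0" "(2 + 2 :: 3) \<noteq> 0" "(1 + 1 :: 3) \<noteq> 0" by simp_all
    then show ?thesis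
      using exhaust3[of "rot g"] by (elim disjE) (simp_all add: A(3) B_def om_def prod_eq_iff)
  qed
  moreover have "B 0 + B 1 + B 2 = geom (u + 1)"
  proof -
    have "(2 + 1 :: 3) = 0" "(1 + 2 :: 3) = 0" "(2 + 2 :: 3) \<noteq> 0" "(1 + 1 :: 3) \<noteq> 0" by simp_all
    then show ?thesis unfolding geom_Suc A(4)[symmetric]
      using exhaust3[of "rot g"] by (elim disjE) (simp_all add: B_def ac_simps)
  qed
  ultimately show ?case using A(2) by (intro exI[of _ B] exI[of _ "u + 1"]) (auto simp: ac_simps)
qed

text \<open>Modulo 1 - \<omega> the class counts the letters \<open>gb\<close>, while
  \<open>rot\<close> counts the letters \<open>ga\<close> and \<open>s\<close> counts both.\<close>

lemma cl_eps: "cl g l s \<Longrightarrow> eps l = s - rot g"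
  by (induction rule: cl.induct) (auto simp: eps_def[of "(1, 0)"])

text \<open>Divisibility by \<open>(1 - \<omega>)\<^sup>k\<close>.\<close>

primrec dv :: "nat \<Rightarrow> eisenstein \<Rightarrow> bool" where
  "dv 0 p = True"
| "dv (Suc k) p = (\<exists>q. dv k q \<and> p = q - om q)"

lemma dv_add: "dv k p \<Longrightarrow> dv k q \<Longrightarrow> dv k (p + q)"
proof (induction k arbitrary: p q)
  case (Suc k)
  then obtain p' q' where "dv k p'" "dv k q'" "p = p' - om p'" "q = q' - om q'" by auto
  then show ?case using Suc.IH[of p' q'] by (auto simp del: split_paired_Ex intro!: exI[of _ "p' + q'"])
qed simp

lemma dv_minus: "dv k p \<Longrightarrow> dv k (- p)"
proof (induction k arbitrary: p)
  case (Suc k)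
  then obtain p' where "dv k p'" "p = p' - om p'" by auto
  then show ?case using Suc.IH[of p'] by (auto simp del: split_paired_Ex intro!: exI[of _ "- p'"])
qed simp

lemma dv_om: "dv k p \<Longrightarrow> dv k (om p)"
proof (induction k arbitrary: p)
  case (Suc k)
  then obtain p' where "dv k p'" "p = p' - om p'" by auto
  then show ?case using Suc.IH[of p'] by (auto simp del: split_paired_Ex intro!: exI[of _ "om p'"])
qed simp

lemma dv_double: "dv (2 * k) p \<Longrightarrow> \<exists>q. p = (3 ^ k * fst q, 3 ^ k * snd q)"
proof (induction k arbitrary: p)
  case (Suc k)
  then obtain q where q: "dv (2 * k) q" "p = (q - om q) - om (q - om q)" by auto
  obtain r where "q = (3 ^ k * fst r, 3 ^ k * snd r)" using Suc.IH[OF q(1)] by blast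
  \<comment> \<open>The witness comes from (1 - \<omega>)^2 = -3\<omega>.\<close>
  then have "p = (3 ^ Suc k * fst (- om r), 3 ^ Suc k * snd (- om r))"
    by (simp add: q(2) om_def prod_eq_iff algebra_simps)
  then show ?case by blast
qed auto

lemma dv_all_zero:
  assumes "\<And>k. dv k p"
  shows "p = 0"
proof -
  have zero: "z = 0" if "\<And>k. 3 ^ k dvd z" for z :: int
  proof (rule ccontr)
    assume "z \<noteq> 0"
    with that[of "nat \<bar>z\<bar>"] have "3 ^ nat \<bar>z\<bar> \<le> \<bar>z\<bar>"
      using dvd_imp_le_int[of z "3 ^ nat \<bar>z\<bar>"] by (simp add: power_abs)
    moreover have "int (nat \<bar>z\<bar>) < int (3 ^ nat \<bar>z\<bar>)"
      unfolding of_nat_less_iff by (rule power_gt_expt) simp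
    ultimately show False by simp
  qed
  have "3 ^ k dvd fst p \<and> 3 ^ k dvd snd p" for k
    using dv_double[OF assms[of "2 * k"]] by auto
  then show ?thesis using zero[of "fst p"] zero[of "snd p"] by (simp add: prod_eq_iff)
qed

section \<open>Level stabilizers and the classes of their elements\<close>

primrec stab :: "nat \<Rightarrow> gg set" where
  "stab 0 = UNIV"
| "stab (Suc n) = {g. rot g = 0 \<and> (\<forall>x. sec g x \<in> stab n)}"

lemma stab_antimono: "m \<le> n \<Longrightarrow> stab n \<subseteq> stab m"
proof (induction n arbitrary: m)
  case (Suc n)
  then show ?case by (cases m) auto
qed simp

lemma zero_in_stab: "0 \<in> stab n"
  by (induction n) auto

lemma subgrp_stab: "subgrp (stab n)"
  by (induction n) (auto simp: subgrp_def zero_in_stab)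

text \<open>The sections fix the first level, so by \<open>cl_eps\<close> each of their classes has
  residue \<open>u\<close>. Their sum has residue 3u = 0, but also
  \<open>eps (geom u) = u\<close>.\<close>

lemma stab2_cl:
  assumes "cl g l s" "g \<in> stab 2"
  shows "s = 0"
proof -
  obtain A u where A: "\<forall>x. cl (sec g x) (A x) u" "s = rot g + u" "A 0 + A 1 + A 2 = geom u"
    using cl_sections[OF assms(1)] by blast
  have "eps (A x) = u" for x
    using cl_eps[OF A(1)[rule_format, of x]] assms(2) by (simp add: numeral_2_eq_2)
  then have "u + u + u = u" using arg_cong[OF A(3), of eps] by (simp add: eps_geom)
  moreover have "(2 + 2 + 2 :: 3) = 0" "(1 + 1 + 1 :: 3) = 0" by simp_all
  ultimately have "u = 0" using exhaust3[of u] by metis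
  then show ?thesis using A(2) assms(2) by (simp add: numeral_2_eq_2)
qed

text \<open>The offset 2 keeps \<open>stab2_cl\<close> applicable at every stage. It gives
  \<open>s = 0\<close>, so the section classes sum to zero, and eliminating \<open>A 0\<close> from
  the weighted sum leaves a factor 1 - \<omega>.\<close>

lemma stab_cl: "cl g l s \<Longrightarrow> g \<in> stab (Suc (Suc k)) \<Longrightarrow> s = 0 \<and> dv k l"
proof (induction k arbitrary: g l s)
  case 0
  then show ?case using stab2_cl by (simp add: numeral_2_eq_2)
next
  case (Suc k)
  obtain A u where A: "\<forall>x. cl (sec g x) (A x) u" "s = rot g + u"
    "l = omp (rot g) (A 0 + om (A 1) + om (om (A 2)))" "A 0 + A 1 + A 2 = geom u"
    using cl_sections[OF Suc.prems(1)] by blast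
  have g: "rot g = 0" "\<And>x. sec g x \<in> stab (Suc (Suc k))" using Suc.prems(2) by auto
  have "g \<in> stab 2" using Suc.prems(2) stab_antimono[of 2 "Suc (Suc (Suc k))"] by auto
  then have s: "s = 0" using stab2_cl Suc.prems(1) by blast
  then have "A 0 = - A 1 - A 2" using A(2,4) g(1)
    by (simp add: geom_def eq_neg_iff_add_eq_0 eq_diff_eq add.assoc algebra_simps)
  then have "l = (- A 1 + - A 2 + - om (A 2)) - om (- A 1 + - A 2 + - om (A 2))"
    by (simp add: A(3) g(1) om_def prod_eq_iff)
  moreover have "dv k (- A 1 + - A 2 + - om (A 2))"
    using Suc.IH[OF A(1)[rule_format] g(2)] by (intro dv_add dv_minus dv_om) blast+
  ultimately show ?case using s unfolding dv.simps by blast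
qed

lemma cl_zero: "cl 0 l s \<Longrightarrow> l = 0 \<and> s = 0"
  using stab_cl[OF _ zero_in_stab] dv_all_zero by metis

lemma cl_unique:
  assumes "cl g l s" "cl g m t"
  shows "l = m \<and> s = t"
proof -
  obtain n r where n: "cl (- g) n r" using cl_total by blast
  have "l + omp s n = 0" "s + r = 0" "m + omp t n = 0" "t + r = 0"
    using cl_zero cl_add[OF assms(1) n] cl_add[OF assms(2) n] by auto
  then show ?thesis by (metis add_right_cancel)
qed

definition kl :: "gg \<Rightarrow> eisenstein" where
  "kl g = (THE l. \<exists>s. cl g l s)"

definition ks :: "gg \<Rightarrow> 3" where
  "ks g = (THE s. \<exists>l. cl g l s)"

lemma cl_eq: "cl g l s \<Longrightarrow> kl g = l \<and> ks g = s"
  unfolding kl_def ks_def using cl_unique by blast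

lemma cl_kl_ks: "cl g (kl g) (ks g)"
  using cl_total cl_eq by metis

lemma kl_add [simp]: "kl (g + h) = kl g + omp (ks g) (kl h)"
  and ks_add [simp]: "ks (g + h) = ks g + ks h"
  using cl_eq[OF cl_add[OF cl_kl_ks cl_kl_ks]] by auto

lemma kl_gens [simp]: "kl 0 = 0" "ks 0 = 0" "kl ga = 0" "ks ga = 1" "kl gb = (1, 0)" "ks gb = 1"
  using cl_eq[OF cl.zero] cl_eq[OF cl_ga] cl_eq[OF cl_gb] by auto

lemma ks_minus [simp]: "ks (- g) = - ks g"
proof -
  have "ks (- g) + ks g = 0" unfolding ks_add[symmetric] by simp
  then show ?thesis by (simp add: eq_neg_iff_add_eq_0)
qed

lemma kl_minus [simp]: "kl (- g) = - omp (- ks g) (kl g)"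
proof -
  have "kl (- g) + omp (ks (- g)) (kl g) = 0" unfolding kl_add[symmetric] by simp
  then show ?thesis by (simp add: eq_neg_iff_add_eq_0)
qed

lemma ks_diff [simp]: "ks (g - h) = ks g - ks h"
  unfolding diff_conv_add_uminus[of g h] ks_add ks_minus by simp

lemma ks_sec [simp]: "ks (sec g x) = ks g - rot g"
  and kl_sections: "kl g = omp (rot g) (kl (sec g 0) + om (kl (sec g 1)) + om (om (kl (sec g 2))))"
  and kl_sections_sum: "kl (sec g 0) + kl (sec g 1) + kl (sec g 2) = geom (ks g - rot g)"
proof -
  obtain A u where A: "\<forall>x. cl (sec g x) (A x) u" "ks g = rot g + u"
    "kl g = omp (rot g) (A 0 + om (A 1) + om (om (A 2)))" "A 0 + A 1 + A 2 = geom u"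
    using cl_sections[OF cl_kl_ks] by blast
  then have "kl (sec g x) = A x" "ks (sec g x) = u" for x using cl_eq by blast+
  with A show "ks (sec g x) = ks g - rot g"
    "kl g = omp (rot g) (kl (sec g 0) + om (kl (sec g 1)) + om (om (kl (sec g 2))))"
    "kl (sec g 0) + kl (sec g 1) + kl (sec g 2) = geom (ks g - rot g)" by auto
qed

lemma eps_kl: "eps (kl g) = ks g - rot g"
  using cl_eps[OF cl_kl_ks] .

lemma stab_ks: "g \<in> stab 2 \<Longrightarrow> ks g = 0"
  using stab2_cl[OF cl_kl_ks] .

lemma stab_kl: "g \<in> stab (2 + 2 * k) \<Longrightarrow> \<exists>q. kl g = (3 ^ k * fst q, 3 ^ k * snd q)"
  using stab_cl[OF cl_kl_ks, of g "2 * k"] dv_double by auto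

lemma omp_cancel [simp]: "omp s (omp (- s) p) = p" "omp (- s) (omp s p) = p"
  by (simp_all flip: omp_add)

lemma kl_diff [simp]: "kl (g - h) = kl g - omp (ks g - ks h) (kl h)"
proof -
  have "kl (g - h) = kl g + omp (ks g) (- omp (- ks h) (kl h))"
    unfolding diff_conv_add_uminus[of g h] by simp
  then show ?thesis using omp_add[of "ks g" "- ks h" "kl h"]
    by (simp add: diff_conv_add_uminus)
qed

section \<open>The subgroups \<open>K\<close> and \<open>K'\<close>\<close>

definition K :: "gg set" where "K = {g. ks g = 0}"

text \<open>\<open>D\<close> is \<open>K'\<close>. As \<open>K / K'\<close> is generated by the conjugates \<open>y0\<close>, \<open>y1\<close>,
  \<open>y2\<close> of \<open>b a\<^sup>-\<^sup>1\<close>, whose sum is zero, it is also the normal closure \<open>NC\<close> of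
  \<open>[y0, y1]\<close>.\<close>

definition D :: "gg set" where "D = {g. ks g = 0 \<and> kl g = 0}"

lemma D_subset_K: "D \<subseteq> K"
  by (auto simp: D_def K_def)

lemma normal_K: "normal_subgrp K"
  by (auto simp: normal_subgrp_def subgrp_def K_def)

lemma normal_D: "normal_subgrp D"
  by (auto simp: normal_subgrp_def subgrp_def D_def)

lemma subgrp_K: "subgrp K" and subgrp_D: "subgrp D"
  using normal_K normal_D normal_subgrpD(1) by auto

lemma comm_K: "x \<in> K \<Longrightarrow> y \<in> K \<Longrightarrow> comm x y \<in> D"
  by (simp add: K_def D_def comm_def)

lemma rot_D: "g \<in> D \<Longrightarrow> rot g = 0"
  using eps_kl[of g] by (simp add: D_def)

lemma sec_D_K: "g \<in> D \<Longrightarrow> sec g x \<in> K"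
  by (simp add: K_def rot_D) (simp add: D_def)

text \<open>Both the weighted and the plain sum of the section classes vanish on K'; the two
  equations leave one free parameter, the class at 0.\<close>

lemma kl_sec_D: "g \<in> D \<Longrightarrow> kl (sec g x) = omp x (kl (sec g 0))"
proof -
  assume g: "g \<in> D"
  have "kl (sec g 0) + om (kl (sec g 1)) + om (om (kl (sec g 2))) = 0"
    "kl (sec g 0) + kl (sec g 1) + kl (sec g 2) = 0"
    using kl_sections[of g] kl_sections_sum[of g] rot_D[OF g] g by (auto simp: D_def geom_def)
  then have "kl (sec g 1) = om (kl (sec g 0))" "kl (sec g 2) = om (om (kl (sec g 0)))"
    by (auto simp: om_def prod_eq_iff)
  then show ?thesis using exhaust3[of x] by auto
qed

definition y0 :: gg where "y0 = gb - ga"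
definition y1 :: gg where "y1 = ga + y0 - ga"
definition y2 :: gg where "y2 = ga + y1 - ga"
definition y01 :: gg where "y01 = comm y0 y1"
definition NC :: "gg set" where "NC = gen {h + y01 - h |h. True}"

lemma y_K: "y0 \<in> K" "y1 \<in> K" "y2 \<in> K"
  by (simp_all add: K_def y0_def y1_def y2_def)

lemma y01_D: "y01 \<in> D"
  unfolding y01_def by (intro comm_K y_K)

lemma ga_cube_minus: "- ga + (- ga + - ga) = 0"
  using arg_cong[OF ga_cube, of uminus] by (simp add: minus_add add.assoc)

lemma y_sum: "y0 + y1 + y2 = 0"
proof -
  have "y0 + y1 + y2 = gb + (gb + gb) + (- ga + (- ga + - ga))"
    by (simp add: y0_def y1_def y2_def grp_simps)
  then show ?thesis using gb_cube ga_cube_minus by simp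
qed

lemma y2_shift: "ga + y2 - ga = y0"
proof -
  have "ga + y2 - ga = (ga + (ga + ga)) + y0 + (- ga + (- ga + - ga))"
    by (simp add: y1_def y2_def grp_simps)
  then show ?thesis using ga_cube ga_cube_minus by simp
qed

lemma normal_NC: "normal_subgrp NC"
  unfolding NC_def
proof (rule normal_gen)
  fix g s assume "s \<in> {h + y01 - h |h. True}"
  then obtain h where s: "s = h + y01 - h" by auto
  have "g + (h + y01 - h) - g = (g + h) + y01 - (g + h)" by (simp add: grp_simps)
  then show "g + s - g \<in> {h + y01 - h |h. True}" unfolding s by blast
qed

lemma NC_subset_D: "NC \<subseteq> D"
  unfolding NC_def using normal_subgrpD(2)[OF normal_D y01_D] by (intro gen_subset subgrp_D) auto

lemma y01_NC: "y01 \<in> NC"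
proof -
  have "y01 = 0 + y01 - 0" by simp
  then show ?thesis unfolding NC_def by (blast intro: gen_incl)
qed

lemma comm_self [simp]: "comm x x = 0" "comm (- x) x = 0"
  by (simp_all add: comm_def grp_simps)

lemma comm_y:
  assumes "normal_subgrp H" "y01 \<in> H"
  shows "comm y0 y1 \<in> H" "comm y0 y2 \<in> H" "comm y1 y2 \<in> H"
proof -
  note cz = subgrp_centralizer[OF assms(1)] and cs = comm_sym[OF assms(1)]
  have y2: "y2 = - (y0 + y1)" using y_sum by (simp add: eq_neg_iff_add_eq_0 minus_unique)
  have 0: "0 \<in> H" by (rule subgrpD(1)[OF normal_subgrpD(1)[OF assms(1)]])
  show 1: "comm y0 y1 \<in> H" using assms(2) by (simp add: y01_def)
  have "y0 + y1 \<in> {g. comm g y0 \<in> H}" "y0 + y1 \<in> {g. comm g y1 \<in> H}"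
    using 0 1 cs[of y0 y1] by (intro subgrpD(2)[OF cz]; simp)+
  then show "comm y0 y2 \<in> H" "comm y1 y2 \<in> H"
    unfolding y2 using cs subgrpD(3)[OF cz] by blast+
qed

lemma of_nat3: "of_nat n = (0::3) \<Longrightarrow> 3 dvd n"
proof -
  assume "of_nat n = (0::3)"
  have "n = 3 * (n div 3) + n mod 3" by simp
  then have of_nat_n: "(of_nat n :: 3) = of_nat 3 * of_nat (n div 3) + of_nat (n mod 3)"
    by (metis of_nat_add of_nat_mult)
  have *: "n mod 3 = 0 \<or> n mod 3 = 1 \<or> n mod 3 = 2" by auto
  have "(of_nat 3 :: 3) = 0" by simp
  with of_nat_n have "of_nat (n mod 3) = (0::3)"
    using \<open>of_nat n = 0\<close> by (simp only: mult_zero_left add_0)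
  with * show ?thesis by auto
qed

lemma ks_nmul [simp]: "ks (nmul n g) = of_nat n * ks g"
  by (induction n) (auto simp: algebra_simps)

lemma kl_nmul_K: "ks g = 0 \<Longrightarrow> kl (nmul n g) = (int n * fst (kl g), int n * snd (kl g))"
  by (induction n) (auto simp: algebra_simps prod_eq_iff)

lemma kl_y [simp]: "kl y0 = (1, 0)" "kl y1 = (0, 1)" "kl y2 = (-1, -1)"
  "ks y0 = 0" "ks y1 = 0" "ks y2 = 0"
  by (simp_all add: y0_def y1_def y2_def om_def)

text \<open>Modulo \<open>NC\<close> the three conjugates commute and \<open>ga\<close> permutes
  them cyclically; left multiplication by \<open>gb = y0 + ga\<close> is the step for
  \<open>ga\<close> followed by an increment of \<open>p\<close>. Keeping all three allows natural
  exponents.\<close>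

lemma normal_form_NC:
  "\<exists>p q r t. eqm NC g (nmul p y0 + nmul q y1 + nmul r y2 + nmul t ga)"
proof -
  note nN = normal_NC
  have step: "\<exists>p q r t. eqm NC (ga + g) (nmul p y0 + nmul q y1 + nmul r y2 + nmul t ga)"
    if g: "\<exists>p q r t. eqm NC g (nmul p y0 + nmul q y1 + nmul r y2 + nmul t ga)" for g
  proof -
    obtain p q r t where g: "eqm NC g (nmul p y0 + nmul q y1 + nmul r y2 + nmul t ga)"
      using g by blast
    have y: "nmul p y1 = ga + nmul p y0 - ga" "nmul q y2 = ga + nmul q y1 - ga"
      "nmul r y0 = ga + nmul r y2 - ga"
      unfolding nmul_conj[symmetric] y2_shift by (simp_all add: y1_def y2_def)
    have eq: "ga + (nmul p y0 + nmul q y1 + nmul r y2 + nmul t ga)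
      = (nmul p y1 + nmul q y2) + nmul r y0 + nmul (Suc t) ga"
      unfolding y by (simp add: grp_simps)
    have "comm (nmul p y1 + nmul q y2) (nmul r y0) \<in> NC"
    proof -
      have "comm (nmul p y1) (nmul r y0) \<in> NC" "comm (nmul q y2) (nmul r y0) \<in> NC"
        using comm_y[OF nN y01_NC] comm_sym[OF nN] by (auto intro!: comm_nmul[OF nN])
      then show ?thesis using subgrpD(2)[OF subgrp_centralizer[OF nN]] by blast
    qed
    then have swap: "eqm NC ((nmul p y1 + nmul q y2) + nmul r y0 + nmul (Suc t) ga)
      (nmul r y0 + (nmul p y1 + nmul q y2) + nmul (Suc t) ga)"
      unfolding eqm_comm[OF nN] by (rule eqm_add[OF nN _ eqm_refl[OF nN]])
    have "eqm NC (ga + g) ((nmul p y1 + nmul q y2) + nmul r y0 + nmul (Suc t) ga)"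
      using eqm_add[OF nN eqm_refl[OF nN, of ga] g] unfolding eq .
    from eqm_trans[OF nN this swap]
    have "eqm NC (ga + g) (nmul r y0 + nmul p y1 + nmul q y2 + nmul (Suc t) ga)"
      by (simp only: add.assoc)
    then show ?thesis by blast
  qed
  show ?thesis
  proof (induction g rule: gg_induct)
    case zero
    have "eqm NC 0 (nmul 0 y0 + nmul 0 y1 + nmul 0 y2 + nmul 0 ga)"
      using eqm_refl[OF nN, of 0] by simp
    then show ?case by blast
  next
    case (a g)
    then show ?case by (rule step)
  next
    case (b g)
    then obtain p q r t where "eqm NC (ga + g) (nmul p y0 + nmul q y1 + nmul r y2 + nmul t ga)"
      using step by blast
    from eqm_add[OF nN eqm_refl[OF nN, of y0] this]
    have "eqm NC (gb + g) (nmul (Suc p) y0 + nmul q y1 + nmul r y2 + nmul t ga)"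
      by (simp add: y0_def grp_simps)
    then show ?case by blast
  qed
qed

text \<open>The normal form has class (p - r) + (q - r)\<omega>, so in \<open>D\<close> the three
  exponents agree, 3 divides \<open>t\<close>, and the word collapses by \<open>y_sum\<close>. The
  gain is that conjugates of the single element \<open>y01\<close> generate K'.\<close>

lemma D_eq_NC: "D = NC"
proof
  show "NC \<subseteq> D" by (rule NC_subset_D)
  show "D \<subseteq> NC"
  proof
    note nN = normal_NC
    fix g assume g: "g \<in> D"
    obtain p q r t where X: "eqm NC g (nmul p y0 + nmul q y1 + nmul r y2 + nmul t ga)"
      using normal_form_NC by blast
    then have "eqm D (nmul p y0 + nmul q y1 + nmul r y2 + nmul t ga) g"
      using NC_subset_D by (intro eqm_sym[OF normal_D, of g]) (auto simp: eqm_def)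
    from eqm_in[OF normal_D this g]
    have XD: "ks (nmul p y0 + nmul q y1 + nmul r y2 + nmul t ga) = 0"
      "kl (nmul p y0 + nmul q y1 + nmul r y2 + nmul t ga) = 0" by (auto simp: D_def)
    from XD(1) have "of_nat t = (0::3)" by simp
    from of_nat3[OF this] obtain k where "t = k * 3" by (auto simp: dvd_def)
    then have "nmul t ga = nmul k (nmul 3 ga)" by (simp only: nmul_mult)
    then have t: "nmul t ga = 0" by (simp add: numeral_3_eq_3 ga_cube)
    from XD(2) have "p = r" "q = r" by (auto simp: t kl_nmul_K prod_eq_iff)
    moreover have "eqm NC (nmul r (y0 + y1 + y2)) (nmul r (y0 + y1) + nmul r y2)"
    proof (rule eqm_nmul_add[OF nN])
      have "y0 + y1 = - y2" using y_sum by (simp add: eq_neg_iff_add_eq_0)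
      then show "comm (y0 + y1) y2 \<in> NC" using subgrpD(1)[OF normal_subgrpD(1)[OF nN]] by simp
    qed
    moreover have "eqm NC (nmul r (y0 + y1) + nmul r y2) (nmul r y0 + nmul r y1 + nmul r y2)"
      by (intro eqm_add[OF nN] eqm_refl[OF nN] eqm_nmul_add[OF nN] comm_y[OF nN y01_NC])
    ultimately have "eqm NC g 0"
      using X eqm_trans[OF nN] eqm_sym[OF nN] by (metis t add_0_right y_sum nmul_zero)
    then show "g \<in> NC" by (simp add: eqm_def)
  qed
qed

lemma D_induct [consumes 1, case_names zero add minus]:
  assumes "g \<in> D" "P 0" "\<And>h g. g \<in> D \<Longrightarrow> P g \<Longrightarrow> P ((h + y01 - h) + g)"
    "\<And>h g. g \<in> D \<Longrightarrow> P g \<Longrightarrow> P (- (h + y01 - h) + g)"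
  shows "P g"
proof -
  have "g \<in> gen {h + y01 - h |h. True}" using assms(1) by (simp add: D_eq_NC NC_def)
  then show ?thesis
    by (induction rule: gen.induct) (use assms(2-4) D_eq_NC NC_def in auto)
qed

lemma rigid_generator:
  "\<exists>h. rot h = 0 \<and> (\<forall>x. sec h x = (if x = y then gb else ga))"
proof -
  have "(1 + 1 :: 3) = 2" "(2 - 1 :: 3) = 1" "(1 - 2 :: 3) = 2" "(0 - 1 :: 3) = 2" "(0 - 2 :: 3) = 1"
    by simp_all
  then show ?thesis
    using exhaust3[of y]
    by (elim disjE; intro exI[of _ "if y = 0 then gb else if y = 1 then ga + gb - ga
        else ga + ga + gb - ga - ga"]) (auto simp: all3)
qed

text \<open>Sections at \<open>x\<close> multiply for elements fixing the first level, so realising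
  the two generators suffices; a conjugate of \<open>gb\<close> with its section \<open>gb\<close>
  at \<open>x + 1\<close> realises \<open>ga\<close>.\<close>

lemma section_surj: "\<exists>h. rot h = 0 \<and> sec h x = g"
proof (induction g rule: gg_induct)
  case zero
  show ?case by (rule exI[of _ 0]) simp
next
  case (a g)
  then obtain h where h: "rot h = 0" "sec h x = g" by blast
  obtain k where k: "rot k = 0" "\<forall>z. sec k z = (if z = x + 1 then gb else ga)"
    using rigid_generator[of "x + 1"] by blast
  then show ?case using h by (intro exI[of _ "k + h"]) auto
next
  case (b g)
  then obtain h where h: "rot h = 0" "sec h x = g" by blast
  obtain k where k: "rot k = 0" "\<forall>z. sec k z = (if z = x then gb else ga)"
    using rigid_generator[of x] by blast
  then show ?case using h by (intro exI[of _ "k + h"]) auto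
qed

section \<open>\<open>K'\<close> is geometrically contained in itself\<close>

definition is_lift :: "3 \<Rightarrow> gg \<Rightarrow> gg \<Rightarrow> bool" where
  "is_lift x d h \<longleftrightarrow> rot h = 0 \<and> (\<forall>y. sec h y = (if y = x then d else 0))"

lemma is_lift_unique: "is_lift x d h \<Longrightarrow> is_lift x d h' \<Longrightarrow> h = h'"
  unfolding is_lift_def by (rule gg_eqI) auto

lemma is_lift_y01: "\<exists>h\<in>D. is_lift 0 y01 h"
proof -
  define b1 where "b1 = ga + gb - ga"
  define b2 where "b2 = ga + b1 - ga"
  \<comment> \<open>The arguments have sections \<open>y0\<close>, \<open>- y0\<close>, 0 and
    \<open>y1\<close>, 0, \<open>- y1\<close> at 0, 1, 2, so their commutator survives only at 0;
    conjugation by \<open>b1\<close> turns \<open>y0\<close> into \<open>y1\<close> there.\<close>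
  define h where "h = comm (gb - b1) (b1 + (gb - b2) - b1)"
  have "h \<in> D" unfolding h_def by (rule comm_K) (simp_all add: K_def b1_def b2_def)
  moreover have "sec h x = (if x = 0 then y01 else 0)" for x
  proof -
    have "(1 + 1 :: 3) = 2" "(2 - 1 :: 3) = 1" "(1 - 2 :: 3) = 2" "(0 - 1 :: 3) = 2" "(0 - 2 :: 3) = 1"
      by simp_all
    then have 1: "rot b1 = 0" "rot b2 = 0" "sec b1 x = (if x = 1 then gb else ga)"
      "sec b2 x = (if x = 2 then gb else ga)" for x
      using exhaust3[of x] by (auto simp: b1_def b2_def)
    have "sec h 0 = comm y0 (ga + y0 - ga)" "sec h 1 = 0" "sec h 2 = 0"
      by (simp_all add: h_def comm_def 1 y0_def)
    then show ?thesis
      using exhaust3[of x] by (auto simp: y01_def y1_def)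
  qed
  ultimately show ?thesis unfolding is_lift_def using rot_D by blast
qed

text \<open>It suffices to lift conjugates of \<open>y01\<close>. Conjugating a lift by
  \<open>ga\<close> moves it to the next letter, and conjugating by an element with section
  \<open>k\<close> at \<open>x\<close> yields the conjugate by \<open>k\<close>.\<close>

lemma is_lift_exists: "d \<in> D \<Longrightarrow> \<exists>h\<in>D. is_lift x d h"
proof -
  have shift: "\<exists>h\<in>D. is_lift (x + 1) d h" if *: "\<exists>h\<in>D. is_lift x d h" for x d
  proof -
    obtain h where h: "h \<in> D" "is_lift x d h" using * by blast
    then have "is_lift (x + 1) d (ga + h - ga)"
      unfolding is_lift_def by (auto simp: diff_eq_eq)
    then show ?thesis using normal_subgrpD(2)[OF normal_D h(1)] by blast
  qed
  have lift_y01: "\<exists>h\<in>D. is_lift x y01 h" for x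
  proof -
    have "\<exists>h\<in>D. is_lift 1 y01 h" "\<exists>h\<in>D. is_lift 2 y01 h"
      using shift[OF is_lift_y01] shift[OF shift[OF is_lift_y01]] by simp_all
    then show ?thesis using is_lift_y01 exhaust3[of x] by auto
  qed
  have lift_conj: "\<exists>h\<in>D. is_lift x (k + y01 - k) h" for k
  proof -
    obtain g where g: "rot g = 0" "sec g x = k" using section_surj by blast
    obtain h where h: "h \<in> D" "is_lift x y01 h" using lift_y01 by blast
    then have "is_lift x (k + y01 - k) (g + h - g)" using g unfolding is_lift_def by auto
    then show ?thesis using normal_subgrpD(2)[OF normal_D h(1)] by blast
  qed
  assume "d \<in> D"
  then show ?thesis
  proof (induction rule: D_induct)
    case zero
    then show ?case using subgrpD(1)[OF subgrp_D] by (intro bexI[of _ 0]) (auto simp: is_lift_def)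
  next
    case (add k g)
    then obtain h where h: "h \<in> D" "is_lift x g h" by blast
    obtain h' where h': "h' \<in> D" "is_lift x (k + y01 - k) h'" using lift_conj by blast
    show ?case using h h' subgrpD(2)[OF subgrp_D]
      by (intro bexI[of _ "h' + h"]) (auto simp: is_lift_def)
  next
    case (minus k g)
    then obtain h where h: "h \<in> D" "is_lift x g h" by blast
    obtain h' where h': "h' \<in> D" "is_lift x (k + y01 - k) h'" using lift_conj by blast
    show ?case using h h' subgrpD(2,3)[OF subgrp_D]
      by (intro bexI[of _ "- h' + h"]) (auto simp: is_lift_def)
  qed
qed

text \<open>The copy of \<open>d\<close> below the letter \<open>x\<close>, guaranteed to exist for
  \<open>d\<close> in K'.\<close>

definition lft :: "3 \<Rightarrow> gg \<Rightarrow> gg" where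
  "lft x d = (THE h. is_lift x d h)"

lemma lft_eqI: "is_lift x d h \<Longrightarrow> lft x d = h"
  unfolding lft_def using is_lift_unique by blast

lemma lft_D: "d \<in> D \<Longrightarrow> lft x d \<in> D"
  and is_lift_lft: "d \<in> D \<Longrightarrow> is_lift x d (lft x d)"
  using is_lift_exists lft_eqI by blast+

lemma rot_lft [simp]: "d \<in> D \<Longrightarrow> rot (lft x d) = 0"
  and sec_lft [simp]: "d \<in> D \<Longrightarrow> sec (lft x d) y = (if y = x then d else 0)"
  using is_lift_lft unfolding is_lift_def by auto

lemma lft_zero [simp]: "lft x 0 = 0"
  by (rule lft_eqI) (simp add: is_lift_def)

lemma lft_add: "d \<in> D \<Longrightarrow> e \<in> D \<Longrightarrow> lft x (d + e) = lft x d + lft x e"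
  by (rule lft_eqI) (simp add: is_lift_def)

lemma lft_minus: "d \<in> D \<Longrightarrow> lft x (- d) = - lft x d"
  by (rule lft_eqI) (simp add: is_lift_def)

lemma lft_nmul: "d \<in> D \<Longrightarrow> lft x (nmul n d) = nmul n (lft x d)"
  by (induction n) (auto simp: lft_add nmul_in_subgrp subgrp_D)

lemma lft_shift: "d \<in> D \<Longrightarrow> lft (x + 1) d = ga + lft x d - ga"
  by (rule lft_eqI) (auto simp: is_lift_def diff_eq_eq)

lemma lft_comm: "rot g = 0 \<Longrightarrow> sec g x = k \<Longrightarrow> d \<in> D \<Longrightarrow> lft x (comm k d) = comm g (lft x d)"
  by (rule lft_eqI) (auto simp: is_lift_def comm_def)

lemma lft_decomp:
  assumes "rot g = 0" "\<And>x. sec g x \<in> D"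
  shows "g = lft 0 (sec g 0) + lft 1 (sec g 1) + lft 2 (sec g 2)"
proof (rule gg_eqI)
  fix x show "sec g x = sec (lft 0 (sec g 0) + lft 1 (sec g 1) + lft 2 (sec g 2)) x"
    using exhaust3[of x] assms by auto
qed (simp add: assms)

section \<open>Modulo \<open>[K, K']\<close>\<close>

definition Gam :: "gg set" where "Gam = gen {comm k d |k d. k \<in> K \<and> d \<in> D}"

lemma normal_Gam: "normal_subgrp Gam"
  unfolding Gam_def
proof (rule normal_gen)
  fix g s assume "s \<in> {comm k d |k d. k \<in> K \<and> d \<in> D}"
  then obtain k d where s: "s = comm k d" "k \<in> K" "d \<in> D" by auto
  have "g + comm k d - g = comm (g + k - g) (g + d - g)" by (simp add: comm_def grp_simps)
  then show "g + s - g \<in> {comm k d |k d. k \<in> K \<and> d \<in> D}"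
    using s normal_subgrpD(2)[OF normal_K] normal_subgrpD(2)[OF normal_D] by blast
qed

lemma subgrp_Gam: "subgrp Gam"
  by (rule normal_subgrpD(1)[OF normal_Gam])

lemma Gam_subset_D: "Gam \<subseteq> D"
  unfolding Gam_def using comm_K D_subset_K by (intro gen_subset subgrp_D) auto

lemma comm_K_D: "k \<in> K \<Longrightarrow> d \<in> D \<Longrightarrow> comm k d \<in> Gam"
  unfolding Gam_def by (blast intro: gen_incl)

text \<open>K centralizes \<open>y01\<close> modulo \<open>Gam\<close> by definition. By
  \<open>y_sum\<close>, \<open>ga\<close> conjugates \<open>y01\<close> exactly as
  \<open>- (y0 + y1)\<close> does, which lies in K.\<close>

lemma comm_y01: "comm h y01 \<in> Gam"
proof -
  note cz = subgrp_centralizer[OF normal_Gam, of y01]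
  have K: "k \<in> K \<Longrightarrow> k \<in> {g. comm g y01 \<in> Gam}" for k
    using comm_K_D y01_D by auto
  have ga: "ga \<in> {g. comm g y01 \<in> Gam}"
  proof -
    have y2: "y2 = - (y0 + y1)" using y_sum by (simp add: eq_neg_iff_add_eq_0 minus_unique)
    have "ga + y01 - ga = comm y1 y2"
      by (simp add: y01_def comm_def y1_def y2_def grp_simps)
    also have "\<dots> = - (y0 + y1) + y01 + (y0 + y1)"
      unfolding y2 by (simp add: y01_def comm_def grp_simps)
    finally have "comm ga y01 = comm (- (y0 + y1)) y01"
      by (simp add: comm_def grp_simps)
    moreover have "- (y0 + y1) \<in> K" using y_K subgrpD[OF subgrp_K] by blast
    ultimately show ?thesis using comm_K_D y01_D by auto
  qed
  have gb: "gb = y0 + ga" by (simp add: y0_def)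
  have "h \<in> {g. comm g y01 \<in> Gam}"
    by (induction h rule: gg_induct)
      (use ga K[OF y_K(1)] subgrpD(1,2)[OF cz] in \<open>auto simp: gb\<close>)
  then show ?thesis by simp
qed

lemma conj_y01: "eqm Gam (h + y01 - h) y01"
  using comm_y01[of h] by (simp add: eqm_def comm_def)

text \<open>The conjugates of \<open>y01\<close> generate K' and are all congruent to
  \<open>y01\<close>, which is central modulo \<open>Gam\<close>; hence K' / [K, K'] is cyclic and
  central.\<close>

lemma comm_D: "d \<in> D \<Longrightarrow> comm h d \<in> Gam"
proof -
  note cz = subgrp_centralizer[OF normal_Gam, of h] and cs = comm_sym[OF normal_Gam]
  have conj: "k + y01 - k \<in> {g. comm g h \<in> Gam}" for k
  proof -
    have "k + y01 - k = comm k y01 + y01" by (simp add: comm_def)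
    moreover have "comm k y01 \<in> {g. comm g h \<in> Gam}" "y01 \<in> {g. comm g h \<in> Gam}"
      using comm_y01 cs comm_in_normal[OF normal_Gam disjI1[OF comm_y01]] by auto
    ultimately show ?thesis using subgrpD(2)[OF cz] by metis
  qed
  assume "d \<in> D"
  then have "d \<in> {g. comm g h \<in> Gam}"
    by (induction rule: D_induct) (use conj subgrpD[OF cz] in blast)+
  then show ?thesis using cs by simp
qed

lemma rot_nmul [simp]: "rot (nmul n g) = of_nat n * rot g"
  by (induction n) (auto simp: algebra_simps)

lemma sec_nmul [simp]: "rot g = 0 \<Longrightarrow> sec (nmul n g) x = nmul n (sec g x)"
  by (induction n) auto

section \<open>Section classes of elements of K'\<close>

text \<open>Conjugation by \<open>y0\<close> brings the section at 1 to 0, a factor \<omega> by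
  \<open>kl_sec_D\<close>, and conjugates it by an element whose \<open>ks\<close> is 1, another
  factor \<omega>.\<close>

lemma kl_sec_conj_y0:
  assumes "d \<in> D"
  shows "kl (sec (y0 + d - y0) 0) = om (om (kl (sec d 0)))"
proof -
  have "ks (sec y0 1) = 1" by (simp only: ks_sec) (simp add: y0_def)
  moreover have "ks (sec d 1) = 0" using sec_D_K[OF assms] by (simp add: K_def)
  moreover have "rot y0 = - 1" by (simp add: y0_def)
  ultimately show ?thesis
    using rot_D[OF assms] kl_sec_D[OF assms, of 1] by simp
qed

text \<open>The value 1 + \<omega> = -\<omega>^2 is a unit; this is why the section classes of K'
  fill \<int>[\<omega>].\<close>

lemma kl_sec_y01: "kl (sec y01 0) = (1, 1)"
proof -
  have "(- 1 :: 3) = 2" "(- 2 :: 3) = 1" "(1 + 1 :: 3) = 2" "(2 - 1 :: 3) = 1" "(1 - 2 :: 3) = 2"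
      "(0 - 1 :: 3) = 2" "(0 - 2 :: 3) = 1"
    by simp_all
  then show ?thesis
    by (simp add: y01_def comm_def y1_def y0_def om_def)
qed

lemma section_basis:
  "\<exists>e0\<in>D. \<exists>e1\<in>D. \<exists>e2\<in>D. kl (sec e0 0) = (1, 0) \<and> kl (sec e1 0) = (0, 1) \<and>
    kl (sec e2 0) = (-1, -1)"
proof -
  define e2 where "e2 = - y01"
  define e1 where "e1 = y0 + e2 - y0"
  define e0 where "e0 = y0 + e1 - y0"
  have D: "e2 \<in> D" "e1 \<in> D" "e0 \<in> D"
    unfolding e0_def e1_def e2_def
    using y01_D subgrpD(3)[OF subgrp_D] normal_subgrpD(2)[OF normal_D] by auto
  have "ks (sec y01 0) = 0" using sec_D_K[OF y01_D, of 0] unfolding K_def by simp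
  then have 2: "kl (sec e2 0) = (-1, -1)"
    using rot_D[OF y01_D] by (simp add: e2_def kl_sec_y01 del: ks_sec)
  then have 1: "kl (sec e1 0) = (0, 1)"
    unfolding e1_def kl_sec_conj_y0[OF D(1)] by (simp add: om_def)
  then have "kl (sec e0 0) = (1, 0)"
    unfolding e0_def kl_sec_conj_y0[OF D(2)] by (simp add: om_def)
  with 1 2 D show ?thesis by blast
qed

text \<open>Coordinates in 1, \<omega>, \<omega>^2; their zero sum allows nonnegative coefficients,
  as \<open>nmul\<close> requires.\<close>

lemma eisenstein_triple: "\<exists>p q r. v = (int p - int r, int q - int r)"
proof -
  define r where "r = nat \<bar>fst v\<bar> + nat \<bar>snd v\<bar>"
  have "0 \<le> fst v + int r" "0 \<le> snd v + int r" unfolding r_def by linarith+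
  then have "v = (int (nat (fst v + int r)) - int r, int (nat (snd v + int r)) - int r)"
    by (simp add: prod_eq_iff)
  then show ?thesis by blast
qed

lemma ks_sec_D [simp]: "d \<in> D \<Longrightarrow> ks (sec d x) = 0"
  using sec_D_K by (auto simp: K_def)

lemma section_combination:
  assumes "kl (sec e0 0) = (1, 0)" "kl (sec e1 0) = (0, 1)" "kl (sec e2 0) = (-1, -1)"
    "e0 \<in> D" "e1 \<in> D" "e2 \<in> D"
  shows "kl (sec (nmul m (nmul p e0) + nmul m (nmul q e1) + nmul m (nmul r e2)) 0)
    = (int m * (int p - int r), int m * (int q - int r))"
  using assms rot_D by (simp add: kl_nmul_K algebra_simps del: ks_sec)

lemma section_class_surj: "\<exists>d\<in>D. kl (sec d x) = v"
proof -
  obtain e0 e1 e2 where e: "e0 \<in> D" "e1 \<in> D" "e2 \<in> D"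
    "kl (sec e0 0) = (1, 0)" "kl (sec e1 0) = (0, 1)" "kl (sec e2 0) = (-1, -1)"
    using section_basis by blast
  obtain p q r where v: "omp (- x) v = (int p - int r, int q - int r)"
    using eisenstein_triple by blast
  define d where "d = nmul 1 (nmul p e0) + nmul 1 (nmul q e1) + nmul 1 (nmul r e2)"
  have "kl (sec d 0) = omp (- x) v"
    unfolding d_def section_combination[OF e(4-6,1-3)] v by simp
  moreover have "d \<in> D"
    unfolding d_def using e by (intro subgrpD(2)[OF subgrp_D] nmul_in_subgrp[OF subgrp_D])
  ultimately show ?thesis using kl_sec_D[of d x] by auto
qed

text \<open>Some element of K' has a section of the same class as \<open>k\<close>; the discrepancy
  lies in K' and is supplied by a lift.\<close>

lemma D_section_K:
  assumes "k \<in> K"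
  shows "\<exists>g\<in>D. sec g x = k"
proof -
  obtain g where g: "g \<in> D" "kl (sec g x) = kl k" using section_class_surj by blast
  then have "k - sec g x \<in> D" using assms by (simp add: D_def[THEN eqset_imp_iff] K_def del: ks_sec)
  then show ?thesis using g lft_D rot_D[OF g(1)] subgrpD(2)[OF subgrp_D]
    by (intro bexI[of _ "lft x (k - sec g x) + g"]) auto
qed

text \<open>This is K''.\<close>

definition DD :: "gg set" where "DD = gen {comm d e |d e. d \<in> D \<and> e \<in> D}"

lemma DD_subset_Gam: "DD \<subseteq> Gam"
  unfolding DD_def using comm_K_D D_subset_K by (intro gen_subset subgrp_Gam) auto

lemma Gam_induct [consumes 1, case_names zero add minus]:
  assumes "g \<in> Gam" "P 0"
    "\<And>k d g. k \<in> K \<Longrightarrow> d \<in> D \<Longrightarrow> g \<in> Gam \<Longrightarrow> P g \<Longrightarrow> P (comm k d + g)"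
    "\<And>k d g. k \<in> K \<Longrightarrow> d \<in> D \<Longrightarrow> g \<in> Gam \<Longrightarrow> P g \<Longrightarrow> P (- comm k d + g)"
  shows "P g"
proof -
  have "g \<in> gen {comm k d |k d. k \<in> K \<and> d \<in> D}" using assms(1) by (simp add: Gam_def)
  then show ?thesis
    by (induction rule: gen.induct) (use assms(2-4) Gam_def in auto)
qed

lemma comm_K_D_in_D: "k \<in> K \<Longrightarrow> d \<in> D \<Longrightarrow> comm k d \<in> D"
  using comm_K_D Gam_subset_D by blast

text \<open>Each \<open>k\<close> in K is a section of some \<open>e\<close> in K', so the lift of
  \<open>comm k d\<close> is \<open>comm e (lft x d)\<close>, a commutator of elements of
  K'.\<close>

lemma lft_Gam: "g \<in> Gam \<Longrightarrow> lft x g \<in> DD"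
proof (induction rule: Gam_induct)
  case zero
  then show ?case by (simp add: DD_def gen.zero)
next
  case (add k d g)
  then obtain e where e: "e \<in> D" "sec e x = k" using D_section_K by blast
  have "comm e (lft x d) + lft x g \<in> DD"
    unfolding DD_def using add e lft_D by (intro gen.add) (auto simp: DD_def)
  then show ?case
    using add e comm_K_D_in_D Gam_subset_D lft_comm[OF rot_D[OF e(1)] e(2) add(2)]
    by (subst lft_add) auto
next
  case (minus k d g)
  then obtain e where e: "e \<in> D" "sec e x = k" using D_section_K by blast
  have "- comm e (lft x d) + lft x g \<in> DD"
    unfolding DD_def using minus e lft_D by (intro gen.minus) (auto simp: DD_def)
  moreover have "comm k d \<in> D" "- comm k d \<in> D" "g \<in> D"
    using minus comm_K_D_in_D Gam_subset_D subgrpD(3)[OF subgrp_D] by blast+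
  ultimately show ?case
    using lft_comm[OF rot_D[OF e(1)] e(2) minus(2)] by (simp add: lft_add lft_minus)
qed

text \<open>Conjugation changes section classes of K' only by powers of \<omega>, to which
  \<open>eps\<close> is blind.\<close>

lemma eps_sec_comm:
  assumes "d \<in> D"
  shows "eps (kl (sec (comm k d) 0)) = 0"
proof -
  define s where "s = sec k (- rot k)"
  have "sec (comm k d) 0 = s + sec d (- rot k) - s - sec d 0"
    using rot_D[OF assms] by (simp add: comm_def s_def)
  moreover have "eps (kl (sec d (- rot k))) = eps (kl (sec d 0))"
    using kl_sec_D[OF assms, of "- rot k"] by simp
  ultimately show ?thesis using assms by (simp del: ks_sec)
qed

lemma eps_sec_Gam: "g \<in> Gam \<Longrightarrow> eps (kl (sec g 0)) = 0"
proof (induction rule: Gam_induct)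
  case (add k d g)
  then have "rot g = 0" "rot (comm k d) = 0"
    using rot_D Gam_subset_D comm_K_D_in_D by blast+
  with add.IH show ?case by (simp add: eps_sec_comm add.hyps)
next
  case (minus k d g)
  then have "rot g = 0" "rot (comm k d) = 0"
    using rot_D Gam_subset_D comm_K_D_in_D by blast+
  with minus.IH show ?case by (simp add: eps_sec_comm minus.hyps)
qed simp

lemma D_abelian: "d \<in> D \<Longrightarrow> e \<in> D \<Longrightarrow> comm d e \<in> Gam"
  using comm_D by blast

lemma normal_form_Gam:
  "g \<in> D \<Longrightarrow> \<exists>p. \<exists>d\<in>D. eqm Gam g (nmul p y01 + nmul 3 d)"
proof (induction rule: D_induct)
  case zero
  show ?case using subgrpD(1)[OF subgrp_D]
    by (intro exI[of _ 0] bexI[of _ 0]) (auto simp: eqm_refl normal_Gam)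
next
  case (add h g)
  then obtain p d where d: "d \<in> D" "eqm Gam g (nmul p y01 + nmul 3 d)" by blast
  have "eqm Gam ((h + y01 - h) + g) (y01 + (nmul p y01 + nmul 3 d))"
    by (rule eqm_add[OF normal_Gam conj_y01 d(2)])
  then have "eqm Gam ((h + y01 - h) + g) (nmul (Suc p) y01 + nmul 3 d)"
    by (simp add: grp_simps)
  then show ?case using d(1) by blast
next
  case (minus h g)
  then obtain p d where d: "d \<in> D" "eqm Gam g (nmul p y01 + nmul 3 d)" by blast
  have mc: "- y01 \<in> D" using y01_D subgrpD(3)[OF subgrp_D] by blast
  have "y01 + nmul p y01 = nmul p y01 + y01" using nmul_add[of 1 p y01] nmul_add[of p 1 y01] by simp
  \<comment> \<open>Exponents are natural, so -1 is written as 2 - 3 and the cube is absorbed into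
    \<open>d\<close>.\<close>
  then have eq: "nmul (p + 2) y01 + nmul 3 (- y01) = - y01 + nmul p y01"
    by (simp add: nmul_add numeral_2_eq_2 numeral_3_eq_3 add.assoc)
       (metis add.assoc minus_add_cancel add_minus_cancel add.right_inverse add_0_right)
  have "eqm Gam (- (h + y01 - h) + g) (- y01 + (nmul p y01 + nmul 3 d))"
    by (rule eqm_add[OF normal_Gam eqm_minus[OF normal_Gam conj_y01] d(2)])
  also have "- y01 + (nmul p y01 + nmul 3 d) = nmul (p + 2) y01 + (nmul 3 (- y01) + nmul 3 d)"
    using eq by (simp only: add.assoc[symmetric])
  finally have 1: "eqm Gam (- (h + y01 - h) + g) \<dots>" .
  have "eqm Gam (nmul 3 (- y01 + d)) (nmul 3 (- y01) + nmul 3 d)"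
    by (rule eqm_nmul_add[OF normal_Gam D_abelian[OF mc d(1)]])
  then have "eqm Gam (nmul (p + 2) y01 + (nmul 3 (- y01) + nmul 3 d)) (nmul (p + 2) y01 + nmul 3 (- y01 + d))"
    by (rule eqm_add[OF normal_Gam eqm_refl[OF normal_Gam] eqm_sym[OF normal_Gam]])
  from eqm_trans[OF normal_Gam 1 this] show ?case
    using subgrpD(2)[OF subgrp_D mc d(1)] by blast
qed

text \<open>By \<open>eps_sec_Gam\<close> the residue of the section class at 0 is an invariant
  modulo \<open>Gam\<close>. It is 0 for the lift, since \<open>d\<close> has class 0, and 2p for
  the normal form, so 3 divides \<open>p\<close>.\<close>

lemma lft_cube:
  assumes "d \<in> D"
  shows "\<exists>e\<in>D. eqm Gam (lft 0 d) (nmul 3 e)"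
proof -
  obtain p e where e: "e \<in> D" "eqm Gam (lft 0 d) (nmul p y01 + nmul 3 e)"
    using normal_form_Gam[OF lft_D[OF assms]] by blast
  note roots = rot_D[OF y01_D] rot_D[OF e(1)]
  have "eps (kl (sec (lft 0 d - (nmul p y01 + nmul 3 e)) 0)) = 0"
    by (rule eps_sec_Gam[OF e(2)[unfolded eqm_def]])
  moreover have "kl d = 0" using assms by (simp add: D_def)
  moreover have "eps (kl (sec (nmul n e) 0)) = of_nat n * eps (kl (sec e 0))" if "e \<in> D" for n e
    using rot_D[OF that] ks_sec_D[OF that, of 0]
    by (simp add: kl_nmul_K eps_def algebra_simps del: ks_sec)
  moreover have "(3 :: 3) = 0" by simp
  ultimately have "of_nat p * (2 :: 3) = 0"
    using assms e(1) y01_D roots by (simp add: kl_sec_y01 eps_def[of "(1, 1)"] del: sec_nmul ks_sec)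
  then have "of_nat p * (2 * 2 :: 3) = 0" by (simp only: mult.assoc[symmetric] mult_zero_left)
  moreover have "(2 * 2 :: 3) = 1" by simp
  ultimately have "of_nat p = (0::3)" by (simp only: mult_1_right)
  then obtain q where p: "p = 3 * q" using of_nat3 by (auto simp: dvd_def)
  have "comm (nmul q y01) e \<in> Gam"
    by (intro D_abelian nmul_in_subgrp[OF subgrp_D] y01_D e)
  from eqm_nmul_add[OF normal_Gam this, of 3]
  have "eqm Gam (lft 0 d) (nmul 3 (nmul q y01 + e))"
    using eqm_trans[OF normal_Gam e(2)] eqm_sym[OF normal_Gam] by (metis p nmul_mult)
  then show ?thesis
    using subgrpD(2)[OF subgrp_D nmul_in_subgrp[OF subgrp_D y01_D] e(1)] by blast
qed

section \<open>Normal subgroups of exponent a power of 3\<close>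

text \<open>The geometric cube A \<times> A \<times> A; its iterates on \<open>D\<close> form the
  series through which the proof climbs.\<close>

definition prod3 :: "gg set \<Rightarrow> gg set" where
  "prod3 A = {g. rot g = 0 \<and> (\<forall>x. sec g x \<in> A)}"

lemma prod3_mono: "A \<subseteq> B \<Longrightarrow> prod3 A \<subseteq> prod3 B"
  by (auto simp: prod3_def)

lemma prod3_D: "prod3 D \<subseteq> D"
proof
  fix g assume "g \<in> prod3 D"
  then have g: "rot g = 0" "\<And>x. sec g x \<in> D" by (auto simp: prod3_def)
  have "lft 0 (sec g 0) + lft 1 (sec g 1) + lft 2 (sec g 2) \<in> D"
    by (intro subgrpD(2)[OF subgrp_D] lft_D g)
  then show "g \<in> D" using lft_decomp[OF g] by simp
qed

lemma prod3_pow_D: "(prod3 ^^ n) D \<subseteq> D"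
proof (induction n)
  case (Suc n)
  then show ?case using prod3_mono[OF Suc.IH] prod3_D by auto
qed simp

text \<open>Conjugation by \<open>ga\<close> moves a lift to the next letter and is trivial on K'
  modulo \<open>Gam\<close>.\<close>

lemma lft_eqm: "d \<in> D \<Longrightarrow> eqm Gam (lft x d) (lft 0 d)"
proof -
  assume d: "d \<in> D"
  have step: "eqm Gam (lft (x + 1) d) (lft x d)" for x
    using comm_D[OF lft_D[OF d], of ga x] by (simp add: lft_shift[OF d] eqm_def comm_def)
  have "eqm Gam (lft 1 d) (lft 0 d)" "eqm Gam (lft 2 d) (lft 1 d)" using step[of 0] step[of 1] by auto
  then show ?thesis
    using exhaust3[of x] eqm_trans[OF normal_Gam] eqm_refl[OF normal_Gam] by blast
qed

lemma eqm_in_supset: "subgrp X \<Longrightarrow> Gam \<subseteq> X \<Longrightarrow> eqm Gam x y \<Longrightarrow> y \<in> X \<Longrightarrow> x \<in> X"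
proof -
  assume "subgrp X" "Gam \<subseteq> X" "eqm Gam x y" "y \<in> X"
  then have "(x - y) + y \<in> X" by (intro subgrpD(2)) (auto simp: eqm_def)
  then show ?thesis by simp
qed

text \<open>Pulling \<open>X\<close> back along \<open>lft 0\<close> lowers \<open>k\<close> by one:
  lifts of \<open>Gam\<close> stay in \<open>Gam\<close>, and by \<open>lft_cube\<close> every lift
  is a cube modulo \<open>Gam\<close>. The other two letters follow from
  \<open>lft_eqm\<close>.\<close>

lemma prod3_pow_subset:
  "subgrp X \<Longrightarrow> Gam \<subseteq> X \<Longrightarrow> (\<And>d. d \<in> D \<Longrightarrow> nmul (3 ^ k) d \<in> X) \<Longrightarrow> (prod3 ^^ k) D \<subseteq> X"
proof (induction k arbitrary: X)
  case 0
  then show ?case by auto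
next
  case (Suc k)
  define Y where "Y = {d \<in> D. lft 0 d \<in> X}"
  have Y: "subgrp Y"
    using subgrpD[OF Suc.prems(1)] subgrpD[OF subgrp_D]
    unfolding subgrp_def Y_def by (auto simp: lft_add lft_minus)
  moreover have "Gam \<subseteq> Y"
    using lft_Gam DD_subset_Gam Gam_subset_D Suc.prems(2) unfolding Y_def by blast
  moreover have "nmul (3 ^ k) d \<in> Y" if d: "d \<in> D" for d
  proof -
    obtain e where e: "e \<in> D" "eqm Gam (lft 0 d) (nmul 3 e)" using lft_cube[OF d] by blast
    have "eqm Gam (lft 0 (nmul (3 ^ k) d)) (nmul (3 ^ Suc k) e)"
      using eqm_nmul[OF normal_Gam e(2), of "3 ^ k"]
      by (simp only: lft_nmul[OF d] nmul_mult[symmetric] power_Suc mult.commute)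
    then show ?thesis
      using eqm_in_supset[OF Suc.prems(1,2)] Suc.prems(3)[OF e(1)] nmul_in_subgrp[OF subgrp_D d]
      unfolding Y_def by blast
  qed
  ultimately have IH: "(prod3 ^^ k) D \<subseteq> Y" by (rule Suc.IH)
  show ?case
  proof
    fix g assume "g \<in> (prod3 ^^ Suc k) D"
    then have g: "rot g = 0" "\<And>x. sec g x \<in> Y" "\<And>x. sec g x \<in> D"
      using IH by (auto simp: prod3_def Y_def)
    have "lft x (sec g y) \<in> X" for x y
      using eqm_in_supset[OF Suc.prems(1,2) lft_eqm[OF g(3)]] g(2) by (auto simp: Y_def)
    then have "lft 0 (sec g 0) + lft 1 (sec g 1) + lft 2 (sec g 2) \<in> X"
      by (intro subgrpD(2)[OF Suc.prems(1)])
    then show "g \<in> X" using lft_decomp[OF g(1,3)] by simp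
  qed
qed

section \<open>Sections and lifts at arbitrary vertices\<close>

lemma length_act [simp]: "length (act g v) = length v"
  by (induction v arbitrary: g) auto

primrec secv :: "gg \<Rightarrow> vertex \<Rightarrow> gg" where
  "secv g [] = g"
| "secv g (x # v) = secv (sec g x) v"

primrec lftv :: "vertex \<Rightarrow> gg \<Rightarrow> gg" where
  "lftv [] d = d"
| "lftv (x # v) d = lft x (lftv v d)"

lemma lftv_D: "d \<in> D \<Longrightarrow> lftv v d \<in> D"
  by (induction v) (auto simp: lft_D)

lemma lftv_append: "lftv (v @ w) d = lftv v (lftv w d)"
  by (induction v) auto

lemma lftv_zero [simp]: "lftv v 0 = 0"
  by (induction v) auto

lemma lftv_add: "d \<in> D \<Longrightarrow> e \<in> D \<Longrightarrow> lftv v (d + e) = lftv v d + lftv v e"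
  by (induction v) (auto simp: lft_add lftv_D)

lemma lftv_minus: "d \<in> D \<Longrightarrow> lftv v (- d) = - lftv v d"
  by (induction v) (auto simp: lft_minus lftv_D)

lemma lftv_nmul: "d \<in> D \<Longrightarrow> lftv v (nmul n d) = nmul n (lftv v d)"
  by (induction v) (auto simp: lft_nmul lftv_D)

lemma lftv_comm: "d \<in> D \<Longrightarrow> e \<in> D \<Longrightarrow> lftv v (comm d e) = comm (lftv v d) (lftv v e)"
  unfolding comm_def diff_conv_add_uminus
  by (simp add: lftv_add lftv_minus subgrpD[OF subgrp_D])

lemma lft_conj: "d \<in> D \<Longrightarrow> h + lft x d - h = lft (x + rot h) (sec h x + d - sec h x)"
  using normal_subgrpD(2)[OF normal_D]
  by (intro lft_eqI[symmetric]) (auto simp: is_lift_def diff_eq_eq)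

lemma lftv_conj: "d \<in> D \<Longrightarrow> h + lftv v d - h = lftv (act h v) (secv h v + d - secv h v)"
  by (induction v arbitrary: h) (simp_all add: lft_conj lftv_D)

lemma lftv_commute:
  assumes "d \<in> D" "e \<in> D"
  shows "length u = length v \<Longrightarrow> u \<noteq> v \<Longrightarrow> lftv u d + lftv v e = lftv v e + lftv u d"
proof (induction u v rule: list_induct2)
  case (Cons x u y v)
  show ?case
  proof (cases "x = y")
    case True
    then show ?thesis using Cons assms by (simp add: lftv_D flip: lft_add)
  next
    case False
    then show ?thesis using assms by - (rule gg_eqI, auto simp: lftv_D)
  qed
qed simp

lemma act_transitive: "length v = length u \<Longrightarrow> \<exists>h. act h v = u"
proof (induction v u rule: list_induct2)
  case Nil
  show ?case by simp
next
  case (Cons x v y u)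
  then obtain h where h: "act h v = u" by blast
  obtain k where k: "rot k = 0" "sec k x = h" using section_surj by blast
  have "(y - x = 0) \<or> y - x = 1 \<or> y - x = 2" by (rule exhaust3)
  then have "y = x \<or> y = x + 1 \<or> y = x + 1 + 1" by (auto simp: diff_eq_eq)
  moreover have "act k (x # v) = x # u" "act (ga + k) (x # v) = (x + 1) # u"
    "act (ga + ga + k) (x # v) = (x + 1 + 1) # u" using h k by simp_all
  ultimately show ?case by blast
qed

text \<open>Double commutator argument: \<open>t\<close>, the conjugate of \<open>h\<close> by
  \<open>g\<close>, lives below another vertex and so commutes with \<open>k\<close>. Hence the
  commutator of \<open>- t + h\<close>, an element of \<open>N\<close>, with \<open>k\<close> is
  conjugate under \<open>t\<close> to \<open>comm h k\<close>.\<close>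

lemma lftv_comm_in_normal:
  assumes N: "normal_subgrp N" "g \<in> N" "act g v \<noteq> v" and d: "d \<in> D" "e \<in> D"
  shows "lftv v (comm d e) \<in> N"
proof -
  define h k where "h = lftv v d" and "k = lftv v e"
  define t where "t = g + h - g"
  have t: "t = lftv (act g v) (secv g v + d - secv g v)"
    unfolding t_def h_def by (rule lftv_conj[OF d(1)])
  have "t + k = k + t"
    unfolding t k_def using N(3) d normal_subgrpD(2)[OF normal_D] by (intro lftv_commute) auto
  then have tk: "t + (- k + - t) = - k"
    by (metis add.assoc add_minus_cancel minus_add minus_add_cancel minus_minus add.right_inverse add_0_right)
  note sg = subgrpD[OF normal_subgrpD(1)[OF N(1)]] and nm = normal_subgrpD[OF N(1)]
  have "g + (h - g - h) \<in> N"
    using sg(2) N(2) nm(2)[OF sg(3)[OF N(2)], of h] by (simp add: grp_simps)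
  then have "t - h \<in> N" by (simp add: t_def grp_simps)
  then have "- t + (- (t - h)) + t \<in> N" by (intro nm(3) sg(3))
  then have "comm (- t + h) k \<in> N" by (intro comm_in_normal[OF N(1)]) (simp add: grp_simps)
  from nm(2)[OF this, of t] have "h + (k + (- h + (t + (- k + - t)))) \<in> N"
    by (simp add: comm_def grp_simps)
  then have "comm h k \<in> N" unfolding tk by (simp add: comm_def grp_simps)
  then show ?thesis unfolding h_def k_def lftv_comm[OF d] .
qed

lemma lftv_Gam_in_normal:
  assumes N: "normal_subgrp N" "g \<in> N" "act g v \<noteq> v"
    and w: "length w = Suc (length v)" and y: "y \<in> Gam"
  shows "lftv w y \<in> N"
proof -
  define u x where "u = butlast w" and "x = last w"
  have "w \<noteq> []" using w by auto
  then have wux: "w = u @ [x]" and "length v = length u" using w by (auto simp: u_def x_def)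
  then obtain h where h: "act h v = u" using act_transitive by blast
  note sg = subgrpD[OF normal_subgrpD(1)[OF N(1)]]
  \<comment> \<open>Conjugation by \<open>h\<close> carries \<open>v\<close> to \<open>u\<close> but
    also conjugates by the section \<open>k\<close>, which is undone in advance.\<close>
  have com: "lftv u (comm d e) \<in> N" if "d \<in> D" "e \<in> D" for d e
  proof -
    define k where "k = secv h v"
    have *: "- k + d + k \<in> D" "- k + e + k \<in> D"
      using that normal_subgrpD(3)[OF normal_D] by auto
    have "comm (- k + d + k) (- k + e + k) \<in> D"
      using * comm_K D_subset_K by blast
    from lftv_conj[OF this, of h v]
    have "h + lftv v (comm (- k + d + k) (- k + e + k)) - h = lftv u (comm d e)"
      unfolding h k_def[symmetric] by (simp add: comm_def grp_simps)
    then show ?thesis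
      using normal_subgrpD(2)[OF N(1) lftv_comm_in_normal[OF N *], of h] by simp
  qed
  have "lftv u z \<in> N \<and> z \<in> D" if "z \<in> DD" for z
    using that unfolding DD_def
  proof (induction rule: gen.induct)
    case zero
    then show ?case using sg(1) subgrpD(1)[OF subgrp_D] by simp
  next
    case (add s z)
    then have "lftv u s \<in> N" "s \<in> D" using com comm_K D_subset_K by blast+
    then show ?case using add sg(2) subgrpD(2)[OF subgrp_D] by (simp add: lftv_add)
  next
    case (minus s z)
    then have "lftv u s \<in> N" "s \<in> D" using com comm_K D_subset_K by blast+
    then show ?case using minus sg(2,3) subgrpD(2,3)[OF subgrp_D]
      by (simp add: lftv_add lftv_minus)
  qed
  \<comment> \<open>Lifting \<open>Gam\<close> by one more letter lands in K'', whose copy at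
    \<open>u\<close> lies in \<open>N\<close>; hence the level one below \<open>v\<close>.\<close>
  from this[OF lft_Gam[OF y]] show ?thesis unfolding wux lftv_append by simp
qed

lemma prod3_pow_in:
  "subgrp N \<Longrightarrow> A \<subseteq> D \<Longrightarrow> (\<And>v d. length v = n \<Longrightarrow> d \<in> A \<Longrightarrow> lftv v d \<in> N) \<Longrightarrow> (prod3 ^^ n) A \<subseteq> N"
proof (induction n arbitrary: N)
  case 0
  then show ?case using "0.prems"(3)[of "[]"] by auto
next
  case (Suc n)
  have sub: "(prod3 ^^ n) A \<subseteq> {d \<in> D. lft x d \<in> N}" for x
  proof (rule Suc.IH)
    show "subgrp {d \<in> D. lft x d \<in> N}"
      using subgrpD[OF Suc.prems(1)] subgrpD[OF subgrp_D]
      unfolding subgrp_def by (auto simp: lft_add lft_minus)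
    show "lftv v d \<in> {d \<in> D. lft x d \<in> N}" if "length v = n" "d \<in> A" for v d
      using that Suc.prems(2) Suc.prems(3)[of "x # v"] lftv_D by auto
  qed (rule Suc.prems(2))
  show ?case
  proof
    fix g assume "g \<in> (prod3 ^^ Suc n) A"
    then have g: "rot g = 0" "\<And>x. sec g x \<in> (prod3 ^^ n) A" by (auto simp: prod3_def)
    then have D: "\<And>x. sec g x \<in> D" and N: "\<And>x y. lft x (sec g y) \<in> N" using sub by blast+
    have "lft 0 (sec g 0) + lft 1 (sec g 1) + lft 2 (sec g 2) \<in> N"
      by (intro subgrpD(2)[OF Suc.prems(1)] N)
    then show "g \<in> N" using lft_decomp[OF g(1) D] by simp
  qed
qed

text \<open>The element \<open>g\<close> has nonzero class 3^k, so it moves some vertex. The depth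
  reached is the level of that vertex, plus one from \<open>lftv_Gam_in_normal\<close>, plus
  \<open>k\<close> from \<open>prod3_pow_subset\<close>.\<close>

lemma normal_contains_prod3_pow:
  assumes N: "normal_subgrp N" "\<And>g. nmul (3 ^ k) g \<in> N"
  shows "\<exists>j. (prod3 ^^ j) D \<subseteq> N"
proof -
  have sN: "subgrp N" by (rule normal_subgrpD(1)[OF N(1)])
  define g where "g = nmul (3 ^ k) y0"
  have "kl g \<noteq> 0" by (simp add: g_def kl_nmul_K prod_eq_iff)
  then have "g \<noteq> 0" by auto
  then obtain v where v: "act g v \<noteq> v" using act_ext[of g 0] by auto
  have "(prod3 ^^ Suc (length v)) ((prod3 ^^ k) D) \<subseteq> N"
  proof (rule prod3_pow_in[OF sN prod3_pow_D])
    fix w :: vertex and d assume w: "length w = Suc (length v)" and d: "d \<in> (prod3 ^^ k) D"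
    define X where "X = {d \<in> D. lftv w d \<in> N}"
    have "(prod3 ^^ k) D \<subseteq> X"
    proof (rule prod3_pow_subset)
      show "subgrp X"
        using subgrpD[OF sN] subgrpD[OF subgrp_D]
        unfolding subgrp_def X_def by (auto simp: lftv_add lftv_minus)
      show "Gam \<subseteq> X"
        using lftv_Gam_in_normal[OF N(1) _ v w] N(2) Gam_subset_D unfolding X_def g_def by blast
      show "nmul (3 ^ k) d \<in> X" if "d \<in> D" for d
        using that N(2) nmul_in_subgrp[OF subgrp_D that] unfolding X_def by (simp add: lftv_nmul)
    qed
    then show "lftv w d \<in> N" using d by (auto simp: X_def)
  qed
  then show ?thesis by (auto simp: funpow_add[symmetric, THEN fun_cong, unfolded o_def] simp del: funpow.simps)
qed

section \<open>Climbing from the geometric powers of \<open>K'\<close> to a level stabilizer\<close>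

text \<open>Three powers suffice because \<open>A / B\<close> will be generated by three elements; that
  their number is bounded lets the property pass to \<open>A \<times> A \<times> A\<close>.\<close>

definition power_stab :: "gg set \<Rightarrow> gg set \<Rightarrow> bool" where
  "power_stab A B \<longleftrightarrow> (\<forall>k. \<exists>m. \<forall>g\<in>A \<inter> stab m. \<exists>u1\<in>A. \<exists>u2\<in>A. \<exists>u3\<in>A. \<exists>n\<in>B.
     g = nmul (3 ^ k) u1 + nmul (3 ^ k) u2 + nmul (3 ^ k) u3 + n)"

text \<open>By \<open>stab_kl\<close>, fixing level 2 + 2k makes the class divisible by 3^k;
  multiples of \<open>y0\<close>, \<open>y1\<close>, \<open>y2\<close> realise the quotient.\<close>

lemma power_stab_K_D: "power_stab K D"
  unfolding power_stab_def
proof (intro allI exI ballI)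
  fix k g assume "g \<in> K \<inter> stab (2 + 2 * k)"
  then have g: "ks g = 0" and "g \<in> stab (2 + 2 * k)" by (auto simp: K_def)
  then obtain v where v: "kl g = (3 ^ k * fst v, 3 ^ k * snd v)" using stab_kl by blast
  obtain p q r where pqr: "v = (int p - int r, int q - int r)" using eisenstein_triple by blast
  define u where "u = nmul (3 ^ k) (nmul p y0) + nmul (3 ^ k) (nmul q y1) + nmul (3 ^ k) (nmul r y2)"
  have "- u + g \<in> D"
    using g v pqr by (simp add: u_def D_def kl_nmul_K algebra_simps zero_prod_def)
  moreover have "g = u + (- u + g)" by simp
  ultimately show "\<exists>u1\<in>K. \<exists>u2\<in>K. \<exists>u3\<in>K. \<exists>n\<in>D.
      g = nmul (3 ^ k) u1 + nmul (3 ^ k) u2 + nmul (3 ^ k) u3 + n"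
    unfolding u_def using nmul_in_subgrp[OF subgrp_K y_K(1)] nmul_in_subgrp[OF subgrp_K y_K(2)]
      nmul_in_subgrp[OF subgrp_K y_K(3)] by blast
qed

text \<open>The same argument for the class of the section at 0, hence one level deeper. Once that
  class vanishes for the remainder, \<open>kl_sec_D\<close> puts all its sections in K'.\<close>

lemma power_stab_D_prod3: "power_stab D (prod3 D)"
proof -
  obtain e0 e1 e2 where e: "e0 \<in> D" "e1 \<in> D" "e2 \<in> D"
    "kl (sec e0 0) = (1, 0)" "kl (sec e1 0) = (0, 1)" "kl (sec e2 0) = (-1, -1)"
    using section_basis by blast
  show ?thesis
    unfolding power_stab_def
  proof (intro allI exI ballI)
    fix k g assume g: "g \<in> D \<inter> stab (Suc (2 + 2 * k))"
    then have gD: "g \<in> D" and "sec g 0 \<in> stab (2 + 2 * k)" by auto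
    then obtain v where v: "kl (sec g 0) = (3 ^ k * fst v, 3 ^ k * snd v)"
      using stab_kl by blast
    obtain p q r where pqr: "v = (int p - int r, int q - int r)" using eisenstein_triple by blast
    define u where "u = nmul (3 ^ k) (nmul p e0) + nmul (3 ^ k) (nmul q e1) + nmul (3 ^ k) (nmul r e2)"
    have kl_u: "kl (sec u 0) = kl (sec g 0)"
      unfolding u_def section_combination[OF e(4-6,1-3)] v pqr by simp
    have uD: "u \<in> D"
      unfolding u_def using e by (intro subgrpD(2)[OF subgrp_D] nmul_in_subgrp[OF subgrp_D])
    define n where "n = - u + g"
    have n: "n \<in> D" unfolding n_def using uD gD subgrpD[OF subgrp_D] by blast
    have "kl (sec n 0) = 0"
      using rot_D[OF uD] rot_D[OF gD] ks_sec_D[OF uD, of 0] kl_u by (simp add: n_def del: ks_sec)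
    then have "sec n x \<in> D" for x
      using kl_sec_D[OF n, of x] ks_sec_D[OF n, of x] unfolding D_def by simp
    then have "n \<in> prod3 D" using rot_D[OF n] by (simp add: prod3_def)
    moreover have "g = u + n" by (simp add: n_def)
    ultimately show "\<exists>u1\<in>D. \<exists>u2\<in>D. \<exists>u3\<in>D. \<exists>n\<in>prod3 D.
        g = nmul (3 ^ k) u1 + nmul (3 ^ k) u2 + nmul (3 ^ k) u3 + n"
      unfolding u_def using e nmul_in_subgrp[OF subgrp_D] by blast
  qed
qed

lemma glue_sections:
  assumes "\<And>x. F x \<in> D"
  shows "\<exists>h. rot h = 0 \<and> (\<forall>x. sec h x = F x)"
proof (intro exI conjI allI)
  fix x show "sec (lft 0 (F 0) + lft 1 (F 1) + lft 2 (F 2)) x = F x"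
    using exhaust3[of x] assms by auto
qed (simp add: assms)

text \<open>The summands are chosen separately for each section; \<open>A \<subseteq> D\<close>
  allows the choices to be glued.\<close>

lemma power_stab_prod3:
  assumes "power_stab A B" "A \<subseteq> D"
  shows "power_stab (prod3 A) (prod3 B)"
  unfolding power_stab_def
proof
  fix k
  obtain m where m: "\<And>g. g \<in> A \<inter> stab m \<Longrightarrow> \<exists>u1\<in>A. \<exists>u2\<in>A. \<exists>u3\<in>A. \<exists>n\<in>B.
      g = nmul (3 ^ k) u1 + nmul (3 ^ k) u2 + nmul (3 ^ k) u3 + n"
    using assms(1) unfolding power_stab_def by metis
  show "\<exists>m. \<forall>g\<in>prod3 A \<inter> stab m. \<exists>u1\<in>prod3 A. \<exists>u2\<in>prod3 A. \<exists>u3\<in>prod3 A. \<exists>n\<in>prod3 B.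
      g = nmul (3 ^ k) u1 + nmul (3 ^ k) u2 + nmul (3 ^ k) u3 + n"
  proof (intro exI ballI)
    fix g assume g: "g \<in> prod3 A \<inter> stab (Suc m)"
    then have "sec g x \<in> A \<inter> stab m" for x by (auto simp: prod3_def)
    then have "\<forall>x. \<exists>u1 u2 u3 n. u1 \<in> A \<and> u2 \<in> A \<and> u3 \<in> A \<and> n \<in> B \<and>
      sec g x = nmul (3 ^ k) u1 + nmul (3 ^ k) u2 + nmul (3 ^ k) u3 + n" using m by blast
    then obtain u1 u2 u3 n where u: "\<And>x. u1 x \<in> A \<and> u2 x \<in> A \<and> u3 x \<in> A \<and> n x \<in> B \<and>
      sec g x = nmul (3 ^ k) (u1 x) + nmul (3 ^ k) (u2 x) + nmul (3 ^ k) (u3 x) + n x"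
      by (metis (no_types))
    obtain h1 where h1: "rot h1 = 0" "\<And>x. sec h1 x = u1 x" using glue_sections[of u1] u assms(2) by blast
    obtain h2 where h2: "rot h2 = 0" "\<And>x. sec h2 x = u2 x" using glue_sections[of u2] u assms(2) by blast
    obtain h3 where h3: "rot h3 = 0" "\<And>x. sec h3 x = u3 x" using glue_sections[of u3] u assms(2) by blast
    define w where "w = nmul (3 ^ k) h1 + nmul (3 ^ k) h2 + nmul (3 ^ k) h3"
    have "rot g = 0" using g by simp
    then have "- w + g \<in> prod3 B" using u h1 h2 h3 by (simp add: prod3_def w_def grp_simps)
    moreover have "g = w + (- w + g)" by simp
    moreover have "h1 \<in> prod3 A" "h2 \<in> prod3 A" "h3 \<in> prod3 A" using u h1 h2 h3 by (auto simp: prod3_def)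
    ultimately show "\<exists>u1\<in>prod3 A. \<exists>u2\<in>prod3 A. \<exists>u3\<in>prod3 A. \<exists>n\<in>prod3 B.
      g = nmul (3 ^ k) u1 + nmul (3 ^ k) u2 + nmul (3 ^ k) u3 + n" unfolding w_def by blast
  qed
qed

lemma power_stab_prod3_pow: "power_stab ((prod3 ^^ j) D) ((prod3 ^^ Suc j) D)"
proof (induction j)
  case 0
  then show ?case using power_stab_D_prod3 by simp
next
  case (Suc j)
  then show ?case using power_stab_prod3[OF Suc prod3_pow_D] by simp
qed

text \<open>A cube has trivial rotation, so each level costs one factor 3.\<close>

lemma nmul_stab: "nmul (3 ^ m) g \<in> stab m"
proof (induction m arbitrary: g)
  case (Suc m)
  have "(3 :: 3) = 0" by simp
  then have h: "rot (nmul 3 g) = 0" by (simp only: rot_nmul of_nat_numeral mult_zero_left)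
  have "nmul (3 ^ Suc m) g = nmul (3 ^ m) (nmul 3 g)"
    by (metis power_Suc2 nmul_mult)
  then show ?case using h Suc.IH by simp
qed simp

text \<open>With exponent \<open>k + m\<close> the powers lie in both \<open>N\<close> and
  \<open>stab m\<close>, so the remainder also fixes level \<open>m\<close> and falls into
  \<open>B \<inter> stab m\<close>.\<close>

lemma power_stab_step:
  assumes "power_stab A B" "subgrp N" "\<And>g. nmul (3 ^ k) g \<in> N" "B \<inter> stab m \<subseteq> N"
  shows "\<exists>l. A \<inter> stab l \<subseteq> N"
proof -
  obtain m1 where m1: "\<And>g. g \<in> A \<inter> stab m1 \<Longrightarrow> \<exists>u1\<in>A. \<exists>u2\<in>A. \<exists>u3\<in>A. \<exists>n\<in>B.
      g = nmul (3 ^ (k + m)) u1 + nmul (3 ^ (k + m)) u2 + nmul (3 ^ (k + m)) u3 + n"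
    using assms(1) unfolding power_stab_def by metis
  have nmul: "nmul (3 ^ (k + m)) x \<in> N \<inter> stab m" for x
  proof -
    have "nmul (3 ^ (k + m)) x = nmul (3 ^ k) (nmul (3 ^ m) x)"
      "nmul (3 ^ (k + m)) x = nmul (3 ^ m) (nmul (3 ^ k) x)"
      by (simp_all add: power_add mult.commute flip: nmul_mult)
    then show ?thesis using assms(3) nmul_stab by (metis IntI)
  qed
  have sg: "subgrp (N \<inter> stab m)" using assms(2) subgrp_stab unfolding subgrp_def by blast
  have "A \<inter> stab (max m m1) \<subseteq> N"
  proof
    fix g assume "g \<in> A \<inter> stab (max m m1)"
    then have g: "g \<in> A \<inter> stab m1" "g \<in> stab m"
      using stab_antimono[of m1 "max m m1"] stab_antimono[of m "max m m1"] by auto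
    obtain u1 u2 u3 n where n: "n \<in> B"
      "g = nmul (3 ^ (k + m)) u1 + nmul (3 ^ (k + m)) u2 + nmul (3 ^ (k + m)) u3 + n"
      using m1[OF g(1)] by blast
    define u where "u = nmul (3 ^ (k + m)) u1 + nmul (3 ^ (k + m)) u2 + nmul (3 ^ (k + m)) u3"
    have u: "u \<in> N \<inter> stab m" unfolding u_def by (intro subgrpD(2)[OF sg] nmul)
    have gn: "g = u + n" using n(2) by (simp add: u_def)
    then have "n = - u + g" by simp
    then have "n \<in> stab m" using u g(2) subgrpD[OF subgrp_stab] by blast
    then have "n \<in> N" using n(1) assms(4) by blast
    then show "g \<in> N" using u subgrpD(2)[OF assms(2)] unfolding gn by blast
  qed
  then show ?thesis by blast
qed

lemma stab_subset_normal:
  assumes N: "normal_subgrp N" "\<And>g. nmul (3 ^ k) g \<in> N"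
  shows "\<exists>n. stab n \<subseteq> N"
proof -
  note step = power_stab_step[OF _ normal_subgrpD(1)[OF N(1)] N(2)]
  have D: "\<exists>l. D \<inter> stab l \<subseteq> N" if "(prod3 ^^ j) D \<inter> stab l \<subseteq> N" for j l
    using that
  proof (induction j arbitrary: l)
    case 0
    then show ?case by auto
  next
    case (Suc j)
    then show ?case using step[OF power_stab_prod3_pow] by blast
  qed
  obtain j where "(prod3 ^^ j) D \<subseteq> N" using normal_contains_prod3_pow[OF N] by blast
  \<comment> \<open>\<open>stab 0\<close> is the whole group, so the climb starts with no level
    condition.\<close>
  then obtain l where "D \<inter> stab l \<subseteq> N" using D[of j 0] by auto
  then obtain m where m: "K \<inter> stab m \<subseteq> N" using step[OF power_stab_K_D] by blast
  \<comment> \<open>Fixing level 2 already forces membership in K.\<close>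
  have "stab (max 2 m) \<subseteq> K \<inter> stab m"
    using stab_antimono[of 2 "max 2 m"] stab_antimono[of m "max 2 m"] stab_ks by (auto simp: K_def)
  then show ?thesis using m by blast
qed

lemma act_fixes_stab: "(\<And>v. length v = n \<Longrightarrow> act g v = v) \<Longrightarrow> g \<in> stab n"
proof (induction n arbitrary: g)
  case (Suc n)
  have *: "x + rot g = x \<and> act (sec g x) v = v" if "length v = n" for x v
    using Suc.prems[of "x # v"] that by simp
  have "rot g = 0" using *[of "replicate n 0" 0] by simp
  then show ?case using Suc.IH * by simp
qed simp

text \<open>Lagrange's theorem in the quotient; it supplies the exponent hypothesis of
  \<open>stab_subset_normal\<close>.\<close>

lemma power_order_in_normal:
  fixes G (structure)
  assumes "N \<lhd> G" "order (G Mod N) = m" "x \<in> carrier G"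
  shows "x [^]\<^bsub>G\<^esub> m \<in> N"
proof -
  interpret normal N G by (rule assms(1))
  interpret Q: group "G Mod N" by (rule factorgroup_is_group)
  have pow: "(N #> x) [^]\<^bsub>G Mod N\<^esub> n = N #> (x [^] n)" for n :: nat
  proof (induction n)
    case 0
    then show ?case by (simp add: FactGroup_def coset_join2 subgroup_axioms)
  next
    case (Suc n)
    then show ?case using assms(3) by (simp add: FactGroup_def rcos_sum)
  qed
  have "N #> x \<in> carrier (G Mod N)" using assms(3) by (auto simp: FactGroup_def RCOSETS_def)
  from Q.pow_order_eq_1[OF this] have "N #> (x [^] m) = N" unfolding assms(2) pow by (simp add: FactGroup_def)
  then show ?thesis using rcos_self[of "x [^] m"] assms(3) subgroup_axioms by auto
qed

theorem mainTheorem4: "has_CSP 3 GGS"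
  unfolding has_CSP_def
proof (intro allI impI)
  let ?G = "AutT\<lparr>carrier := GGS\<rparr>"
  fix N assume "N \<lhd> ?G \<and> finite_p_group 3 (?G Mod N)"
  then obtain k where N: "N \<lhd> ?G" and k: "order (?G Mod N) = 3 ^ k"
    by (auto simp: finite_p_group_def)
  interpret normal N ?G by (rule N)
  \<comment> \<open>\<open>N\<close> is transported to the type \<open>gg\<close>, where the
    additive results apply.\<close>
  define M where "M = {g. act g \<in> N}"
  have act_GGS: "act g \<in> GGS" for g using Rep_gg[of g] by (simp add: act.rep_eq)
  then have act_carrier: "act g \<in> carrier ?G" for g by simp
  have act_add: "act (g + h) = act g \<otimes>\<^bsub>?G\<^esub> act h" for g h by (auto simp: fun_eq_iff)
  have act_zero: "act 0 = \<one>\<^bsub>?G\<^esub>" by (auto simp: fun_eq_iff)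
  have act_minus: "act (- g) = inv\<^bsub>?G\<^esub> (act g)" for g
    by (rule inv_equality[symmetric]) (auto simp: act_GGS fun_eq_iff simp flip: act_simps(1) simp del: act_simps(1))
  have act_nmul: "act (nmul n g) = act g [^]\<^bsub>?G\<^esub> n" for n g
  proof (induction n)
    case 0
    show ?case by (simp add: act_zero)
  next
    case (Suc n)
    have "act (nmul (Suc n) g) = act g \<otimes>\<^bsub>?G\<^esub> act (nmul n g)" by (simp add: act_add)
    then show ?case using Suc nat_pow_Suc2[OF act_carrier] by metis
  qed
  have sub: "subgroup N ?G" by (rule subgroup_axioms)
  have "0 \<in> M" unfolding M_def mem_Collect_eq act_zero by (rule subgroup.one_closed[OF sub])
  moreover have add: "g + h \<in> M" if "g \<in> M" "h \<in> M" for g h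
    using that unfolding M_def mem_Collect_eq act_add by (rule subgroup.m_closed[OF sub])
  moreover have "- g \<in> M" if "g \<in> M" for g
    using that unfolding M_def mem_Collect_eq act_minus by (rule subgroup.m_inv_closed[OF sub])
  moreover have "g + h - g \<in> M" if "h \<in> M" for g h
    using that inv_op_closed2[OF act_carrier, of "act h" g]
    unfolding M_def mem_Collect_eq diff_conv_add_uminus act_add act_minus by blast
  ultimately have "normal_subgrp M" unfolding normal_subgrp_def subgrp_def by blast
  moreover have "nmul (3 ^ k) g \<in> M" for g
    using power_order_in_normal[OF N k act_carrier] by (simp add: M_def act_nmul)
  ultimately obtain n where n: "stab n \<subseteq> M" using stab_subset_normal by blast
  have "level_stab GGS n \<subseteq> N"
  proof
    fix f assume "f \<in> level_stab GGS n"
    then have f: "f \<in> GGS" "\<And>v. length v = n \<Longrightarrow> f v = v" by (auto simp: level_stab_def)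
    have "act (Abs_gg f) = f" using f(1) by (simp add: act.rep_eq Abs_gg_inverse)
    then have "Abs_gg f \<in> stab n" using f(2) by (intro act_fixes_stab) simp
    with n \<open>act (Abs_gg f) = f\<close> show "f \<in> N" by (auto simp: M_def)
  qed
  then show "\<exists>n. level_stab GGS n \<subseteq> N" by blast
qed

end
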